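(* Let $\Omega\subset\mathbb{R}^n$ be a domain and let $u\in L^p(\Omega,E)$ for some $1\le p\le\infty$. Assume that for $p$-a.e. Green domain $U\Subset\Omega$ $$\int_{\partial U}\mathbb{A}(x,\nu(x))u(x)\,d\sigma(x)+\int_U\big(B(x)-\operatorname{div}\mathbb{A}(x)\big)u(x)\,dx=0 .$$ Then $\mathcal{A}u=0$ in $\Omega$ in the sense of distributions.
   Context: $E,F$ are finite-dimensional real Euclidean vector spaces, $\mathcal{L}(E,F)$ the linear maps $E\to F$. A domain is a connected open set. $\mathcal{A}$ is a first order operator $\mathcal{A}u(x)=\sum_{j=1}^nA_j(x)\partial_ju(x)+B(x)u(x)$ with $A_j,B\in C^\infty(\Omega,\mathcal{L}(E,F))$. Its principal symbol is $\mathbb{A}(x,\xi)=\sum_j\xi_jA_j(x)$, and $\operatorname{div}\mathbb{A}(x)=\sum_j\partial_jA_j(x)$. Green domain: a bounded connected open set $U\subset\mathbb{R}^n$ for which there exist a finite Borel measure $\sigma\ge0$ on $\partial U$ and a vector-valued Baire (Borel) function $\nu=(\nu_1,\dots,\nu_n)$, defined $\sigma$-a.e. on $\partial U$ and of unit length, with $\int_U\partial_j\varphi\,dx=\int_{\partial U}\nu_j\varphi\,d\sigma$ for all $\varphi\in C^1(\overline U)$ and all $j$ ($\sigma$ and $\nu$ are then unique). $U\Subset\Omega$ means that $\overline U$ is a compact subset of $\Omega$. $p$-a.e.: a family $\mathscr{E}$ of Green domains is $p$-exceptional if there is a Borel function $\rho:\mathbb{R}^n\to[0,\infty]$ in $L^p(\mathbb{R}^n)$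 with $\int_{\partial U}\rho\,d\sigma=+\infty$ for every $U\in\mathscr{E}$. A property holds for $p$-a.e. Green domain $U\Subset\Omega$ if it holds for all such $U$ outside a $p$-exceptional family. In surface integrals $u$ denotes any fixed Borel representative; the surface integral is defined for $p$-a.e. $U$, and changing the representative changes it only for a $p$-exceptional family. *)

theory Defs
  imports "HOL-Analysis.Analysis"
begin

section \<open>Smooth functions\<close>

definition partial_deriv :: "'n::finite \<Rightarrow> (real^'n \<Rightarrow> 'b::real_normed_vector) \<Rightarrow> real^'n \<Rightarrow> 'b"
  where "partial_deriv j f x = frechet_derivative f (at x) (axis j 1)"

text \<open>Intended for open \<open>S\<close>: \<open>f\<close> has continuous partial derivatives of all orders up to \<open>k\<close>
  on \<open>S\<close>. Requiring differentiability at each stage costs nothing, as it follows from the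
  continuity of the partial derivatives, and it makes \<open>partial_deriv\<close> meaningful.\<close>

primrec Ck_on :: "nat \<Rightarrow> (real^'n::finite \<Rightarrow> 'b::real_normed_vector) \<Rightarrow> (real^'n) set \<Rightarrow> bool" where
  "Ck_on 0 f S \<longleftrightarrow> continuous_on S f"
| "Ck_on (Suc k) f S \<longleftrightarrow> f differentiable_on S \<and> (\<forall>j. Ck_on k (partial_deriv j f) S)"

definition smooth_on :: "(real^'n::finite \<Rightarrow> 'b::real_normed_vector) \<Rightarrow> (real^'n) set \<Rightarrow> bool"
  where "smooth_on f S \<longleftrightarrow> (\<forall>k. Ck_on k f S)"

text \<open>The space \<open>C\<^sup>1\<close> of the closure of an open set \<open>U\<close>: \<open>\<phi>\<close> is \<open>C\<^sup>1\<close> in \<open>U\<close>, and \<open>\<phi>\<close>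
  and its first partial derivatives extend continuously to the closure (the extension of
  \<open>\<phi>\<close> being given by the values of \<open>\<phi>\<close> itself on the frontier).\<close>

definition C1_closure :: "(real^'n::finite \<Rightarrow> real) \<Rightarrow> (real^'n) set \<Rightarrow> bool"
  where "C1_closure \<phi> U \<longleftrightarrow>
    Ck_on 1 \<phi> U \<and> continuous_on (closure U) \<phi> \<and>
    (\<forall>j. \<exists>g. continuous_on (closure U) g \<and> (\<forall>x\<in>U. g x = partial_deriv j \<phi> x))"


section \<open>Lebesgue spaces\<close>

definition in_Lp :: "ennreal \<Rightarrow> 'a measure \<Rightarrow> ('a \<Rightarrow> 'b::euclidean_space) \<Rightarrow> bool"
  where "in_Lp p M f \<longleftrightarrow> f \<in> borel_measurable M \<and>
    (if p = \<infinity> then (\<exists>C. AE x in M. norm (f x) \<le> C)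
     else integrable M (\<lambda>x. norm (f x) powr enn2real p))"

definition in_Lp_ennreal :: "ennreal \<Rightarrow> 'a measure \<Rightarrow> ('a \<Rightarrow> ennreal) \<Rightarrow> bool"
  where "in_Lp_ennreal p M \<rho> \<longleftrightarrow> \<rho> \<in> borel_measurable M \<and>
    (AE x in M. \<rho> x \<noteq> \<infinity>) \<and> in_Lp p M (\<lambda>x. enn2real (\<rho> x))"


section \<open>Green domains and exceptional families\<close>

text \<open>The measure \<open>\<sigma>\<close> lives on the space \<open>frontier U\<close> with its Borel sets; \<open>\<nu>\<close> is a total
  function, only its values \<open>\<sigma>\<close>-almost everywhere matter.\<close>

definition green_data ::
  "(real^'n::finite) set \<Rightarrow> (real^'n) measure \<Rightarrow> (real^'n \<Rightarrow> real^'n) \<Rightarrow> bool"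
  where "green_data U \<sigma> \<nu> \<longleftrightarrow>
    sets \<sigma> = sets (restrict_space borel (frontier U)) \<and> finite_measure \<sigma> \<and>
    \<nu> \<in> borel_measurable \<sigma> \<and> (AE x in \<sigma>. norm (\<nu> x) = 1) \<and>
    (\<forall>\<phi> j. C1_closure \<phi> U \<longrightarrow>
       (LINT x:U|lborel. partial_deriv j \<phi> x) = (LINT x|\<sigma>. \<nu> x $ j * \<phi> x))"

definition green_domain :: "(real^'n::finite) set \<Rightarrow> bool"
  where "green_domain U \<longleftrightarrow>
    bounded U \<and> connected U \<and> open U \<and> (\<exists>\<sigma> \<nu>. green_data U \<sigma> \<nu>)"

text \<open>A Green domain determines \<open>\<sigma>\<close>, and \<open>\<nu>\<close> up to \<open>\<sigma>\<close>-null sets; hence ``the'' surface measure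
  and normal of \<open>U\<close> are rendered by quantifying over all \<open>\<sigma>\<close>, \<open>\<nu>\<close> with \<open>green_data U \<sigma> \<nu>\<close>,
  both here and in \<open>green_identity\<close> below.\<close>

definition p_exceptional :: "ennreal \<Rightarrow> (real^'n::finite) set set \<Rightarrow> bool"
  where "p_exceptional p \<E> \<longleftrightarrow>
    (\<forall>U\<in>\<E>. green_domain U) \<and>
    (\<exists>\<rho>. \<rho> \<in> borel_measurable borel \<and> in_Lp_ennreal p lborel \<rho> \<and>
      (\<forall>U\<in>\<E>. \<forall>\<sigma> \<nu>. green_data U \<sigma> \<nu> \<longrightarrow> (\<integral>\<^sup>+x. \<rho> x \<partial>\<sigma>) = \<infinity>))"

definition compactly_inside :: "(real^'n::finite) set \<Rightarrow> (real^'n) set \<Rightarrow> bool"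
  where "compactly_inside U \<Omega> \<longleftrightarrow> compact (closure U) \<and> closure U \<subseteq> \<Omega>"

definition pae_green_domain ::
  "ennreal \<Rightarrow> (real^'n::finite) set \<Rightarrow> ((real^'n) set \<Rightarrow> bool) \<Rightarrow> bool"
  where "pae_green_domain p \<Omega> P \<longleftrightarrow>
    (\<exists>\<E>. p_exceptional p \<E> \<and>
      (\<forall>U. green_domain U \<and> compactly_inside U \<Omega> \<and> U \<notin> \<E> \<longrightarrow> P U))"


section \<open>First order operators\<close>

text \<open>As \<open>E\<close> and \<open>F\<close> are finite-dimensional, the type of bounded linear functions between them
  consists of all linear maps. The coefficients are \<open>A j\<close> (for \<open>j\<close> in the index type \<open>'n\<close>)
  and \<open>B\<close>.\<close>

definition principal_symbol ::
  "('n::finite \<Rightarrow> real^'n \<Rightarrow> 'e::euclidean_space \<Rightarrow>\<^sub>L 'f::euclidean_space)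
    \<Rightarrow> real^'n \<Rightarrow> real^'n \<Rightarrow> 'e \<Rightarrow>\<^sub>L 'f"
  where "principal_symbol A x \<xi> = (\<Sum>j\<in>UNIV. (\<xi> $ j) *\<^sub>R A j x)"

definition div_symbol ::
  "('n::finite \<Rightarrow> real^'n \<Rightarrow> 'e::euclidean_space \<Rightarrow>\<^sub>L 'f::euclidean_space)
    \<Rightarrow> real^'n \<Rightarrow> 'e \<Rightarrow>\<^sub>L 'f"
  where "div_symbol A x = (\<Sum>j\<in>UNIV. partial_deriv j (A j) x)"

text \<open>If the surface integrand is not \<open>\<sigma>\<close>-integrable, its integral is 0 by the library's
  convention; for \<open>u \<in> L\<^sup>p\<close> this happens only for a \<open>p\<close>-exceptional family of domains \<open>U\<close>
  compactly inside \<open>\<Omega>\<close>.\<close>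

definition green_identity ::
  "('n::finite \<Rightarrow> real^'n \<Rightarrow> 'e::euclidean_space \<Rightarrow>\<^sub>L 'f::euclidean_space)
    \<Rightarrow> (real^'n \<Rightarrow> 'e \<Rightarrow>\<^sub>L 'f) \<Rightarrow> (real^'n \<Rightarrow> 'e) \<Rightarrow> (real^'n) set \<Rightarrow> bool"
  where "green_identity A B u U \<longleftrightarrow>
    (\<forall>\<sigma> \<nu>. green_data U \<sigma> \<nu> \<longrightarrow>
      (LINT x|\<sigma>. blinfun_apply (principal_symbol A x (\<nu> x)) (u x))
      + (LINT x:U|lborel. blinfun_apply (B x - div_symbol A x) (u x)) = 0)"


section \<open>Distributions\<close>

text \<open>A distribution on \<open>\<Omega>\<close> with values in a Euclidean space \<open>E\<close> is regarded as a functional on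
  the \<open>E\<close>-valued test functions, a function \<open>u\<close> acting through the inner product of \<open>E\<close>.
  Derivatives and products with smooth operator-valued functions are defined by duality, as
  usual; the operator \<open>\<A>\<close> is then applied to distributions term by term.\<close>

type_synonym ('n, 'e) dist_functional = "(real^'n \<Rightarrow> 'e) \<Rightarrow> real"

definition test_function :: "(real^'n::finite) set \<Rightarrow> (real^'n \<Rightarrow> 'e::euclidean_space) \<Rightarrow> bool"
  where "test_function \<Omega> \<psi> \<longleftrightarrow>
    smooth_on \<psi> UNIV \<and> compact (closure {x. \<psi> x \<noteq> 0}) \<and> closure {x. \<psi> x \<noteq> 0} \<subseteq> \<Omega>"

definition dist_of_fun ::
  "(real^'n::finite) set \<Rightarrow> (real^'n \<Rightarrow> 'e::euclidean_space) \<Rightarrow> ('n, 'e) dist_functional"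
  where "dist_of_fun \<Omega> u \<psi> = (LINT x:\<Omega>|lborel. u x \<bullet> \<psi> x)"

definition dist_deriv ::
  "'n::finite \<Rightarrow> ('n, 'e::euclidean_space) dist_functional \<Rightarrow> ('n, 'e) dist_functional"
  where "dist_deriv j T \<psi> = - T (partial_deriv j \<psi>)"

definition dist_mult ::
  "(real^'n::finite \<Rightarrow> 'e::euclidean_space \<Rightarrow>\<^sub>L 'f::euclidean_space)
    \<Rightarrow> ('n, 'e) dist_functional \<Rightarrow> ('n, 'f) dist_functional"
  where "dist_mult M T \<psi> = T (\<lambda>x. adjoint (blinfun_apply (M x)) (\<psi> x))"

definition dist_first_order_op ::
  "('n::finite \<Rightarrow> real^'n \<Rightarrow> 'e::euclidean_space \<Rightarrow>\<^sub>L 'f::euclidean_space)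
    \<Rightarrow> (real^'n \<Rightarrow> 'e \<Rightarrow>\<^sub>L 'f) \<Rightarrow> ('n, 'e) dist_functional \<Rightarrow> ('n, 'f) dist_functional"
  where "dist_first_order_op A B T \<psi> =
    (\<Sum>j\<in>UNIV. dist_mult (A j) (dist_deriv j T) \<psi>) + dist_mult B T \<psi>"

definition dist_eq_zero ::
  "(real^'n::finite) set \<Rightarrow> ('n, 'f::euclidean_space) dist_functional \<Rightarrow> bool"
  where "dist_eq_zero \<Omega> T \<longleftrightarrow> (\<forall>\<psi>. test_function \<Omega> \<psi> \<longrightarrow> T \<psi> = 0)"

end

theory Submission
  imports Defs
begin

text \<open>
  It is enough to test the identity on cubes. The idea is to average it over the position of the
  cube, which makes every derivative and every trace fall on a test function instead of \<open>u\<close>. Let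
  \<open>Q\<close> be the cube of side \<open>r\<close> with corner \<open>0\<close>, and let \<open>\<psi>\<close> be a test function. A cube is a Green
  domain (\<open>green_data_cube\<close>); its surface measure is the push-forward of Lebesgue measure on the
  cube under the projections to the facets, and Green's formula is Fubini's theorem together with
  the fundamental theorem of calculus (\<open>cube_divergence_theorem\<close>). For fixed \<open>r\<close>, the translates
  \<open>x + Q\<close> that belong to a \<open>p\<close>-exceptional family form a null set of positions \<open>x\<close>
  (\<open>AE_cube_not_exceptional\<close>). So the assumed identity holds for almost every \<open>x\<close> in the support
  of \<open>\<psi>\<close>, as soon as \<open>r\<close> is small.

  Multiply the identity for \<open>x + Q\<close> by \<open>\<psi> x\<close> and integrate over \<open>x\<close>. By Fubini's theorem
  (\<open>averaging_adjoint\<close>) the surface term becomes the sum over \<open>j\<close> of the integrals of \<open>A\<^sub>j u\<close> at \<open>y\<close>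
  against the surface integral of \<open>\<nu>\<^sub>j(z) \<psi>(y - z)\<close> over the boundary of \<open>Q\<close>. The latter is minus
  the integral of \<open>(\<partial>\<^sub>j \<psi>)(y - z)\<close> over \<open>z \<in> Q\<close>, by the divergence theorem applied to the smooth
  function \<open>\<psi>\<close> rather than to \<open>u\<close>. Divide by the volume \<open>r\<^sup>n\<close> and let \<open>r\<close> tend to \<open>0\<close>: by dominated
  convergence, the integral of \<open>(B - div A) u \<bullet> \<psi> - (\<Sum>j. A\<^sub>j u \<bullet> \<partial>\<^sub>j \<psi>)\<close> vanishes
  (\<open>weak_equation_of_cube_identities\<close>). By the product rule, this integral is the value at \<open>\<psi>\<close>
  of the distribution to which the operator maps \<open>u\<close> (\<open>dist_first_order_op_eq\<close>).
\<close>

section \<open>Fubini's theorem in one coordinate of a cube\<close>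

definition set_coord :: "'n::finite \<Rightarrow> real \<Rightarrow> real^'n \<Rightarrow> real^'n"
  where "set_coord j t z = z + (t - z $ j) *\<^sub>R axis j 1"

lemma set_coord_nth [simp]: "set_coord j t z $ i = (if i = j then t else z $ i)"
  by (simp add: set_coord_def axis_def)

lemma borel_measurable_set_coord [measurable]:
  "(\<lambda>p. set_coord j (snd p) (fst p)) \<in> borel_measurable (borel \<Otimes>\<^sub>M borel)"
  "set_coord j t \<in> borel_measurable borel"
  unfolding set_coord_def borel_prod
  by (intro borel_measurable_continuous_onI continuous_intros)+

text \<open>Lebesgue measure restricted to \<open>0 < z\<^sub>j < r\<close> and normalised so that its projection along the
  \<open>j\<close>-th axis is Lebesgue measure on the other coordinates.\<close>

definition slab :: "'n::finite \<Rightarrow> real \<Rightarrow> (real^'n) measure"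
  where "slab j r = density lborel (\<lambda>z. ennreal (indicator {0<..<r} (z $ j) / r))"

lemma sets_slab [simp, measurable_cong]: "sets (slab j r) = sets borel"
  by (simp add: slab_def)

lemma sigma_finite_slab: "0 < r \<Longrightarrow> sigma_finite_measure (slab j r)"
  unfolding slab_def
  by (subst sigma_finite_measure.sigma_finite_iff_density_finite[OF sigma_finite_lborel]) auto

lemma prod_Basis_cart: "(\<Prod>b\<in>Basis. (x::real^'n::finite) \<bullet> b) = (\<Prod>i\<in>UNIV. x $ i)"
proof -
  have "(\<Prod>b\<in>Basis. x \<bullet> b) = (\<Prod>b\<in>(\<lambda>i. axis i 1) ` UNIV. x \<bullet> b)"
    by (rule prod.cong) (auto simp: Basis_vec_def)
  also have "\<dots> = (\<Prod>i\<in>UNIV. x \<bullet> axis i 1)"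
    by (subst prod.reindex) (auto simp: inj_on_def axis_eq_axis)
  finally show ?thesis by (simp add: cart_eq_inner_axis)
qed

text \<open>Fubini's theorem in one coordinate, without splitting the space \<open>real^'n\<close> into a product:
  discarding the \<open>j\<close>-th coordinate of a point of the normalised slab and drawing a new one from the
  line gives Lebesgue measure back. It is enough to compare boxes, and the preimage of a box under
  the replacement of a coordinate is a rectangle.\<close>

lemma lborel_refill_coordinate:
  fixes j :: "'n::finite"
  assumes r: "0 < r"
  shows "lborel = distr (slab j r \<Otimes>\<^sub>M lborel) borel (\<lambda>p. set_coord j (snd p) (fst p))"
proof (rule lborel_eqI)
  interpret slab: sigma_finite_measure "slab j r" using sigma_finite_slab[OF r] .
  interpret pair_sigma_finite "slab j r" lborel ..
  fix l u :: "real^'n" assume "\<And>b. b \<in> Basis \<Longrightarrow> l \<bullet> b \<le> u \<bullet> b"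
  then have le: "l $ i \<le> u $ i" for i
    by (metis axis_in_Basis_iff cart_eq_inner_axis insert_iff Basis_real_def)
  define S where "S = {z::real^'n. \<forall>i\<in>-{j}. l $ i < z $ i \<and> z $ i < u $ i}"
  have S[measurable]: "S \<in> sets borel" unfolding S_def by measurable
  \<comment> \<open>The replaced coordinate is constrained through the second factor only.\<close>
  have vimage: "(\<lambda>p. set_coord j (snd p) (fst p)) -` box l u \<inter> space (slab j r \<Otimes>\<^sub>M lborel)
      = S \<times> {l $ j<..<u $ j}"
    by (auto simp: S_def mem_box_cart space_pair_measure slab_def split: if_splits)
  have "emeasure (slab j r) S
      = (\<integral>\<^sup>+z. ennreal (indicator {0<..<r} (z $ j) / r) * indicator S z \<partial>lborel)"
    unfolding slab_def by (rule emeasure_density) (auto simp: S)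
  also have "\<dots> = (\<integral>\<^sup>+z. ennreal (1 / r) * indicator (box (set_coord j 0 l) (set_coord j r u)) z \<partial>lborel)"
    by (rule nn_integral_cong) (auto simp: S_def mem_box_cart indicator_def split: if_splits)
  also have "\<dots> = ennreal (1 / r) * emeasure lborel (box (set_coord j 0 l) (set_coord j r u))"
    by (simp add: nn_integral_cmult)
  also have "emeasure lborel (box (set_coord j 0 l) (set_coord j r u))
      = ennreal (\<Prod>b\<in>Basis. (set_coord j r u - set_coord j 0 l) \<bullet> b)"
  proof (rule emeasure_lborel_box)
    fix b :: "real^'n" assume "b \<in> Basis"
    then show "set_coord j 0 l \<bullet> b \<le> set_coord j r u \<bullet> b"
      using le r by (auto simp: Basis_vec_def cart_eq_inner_axis[symmetric])
  qed
  also have "(\<Prod>b\<in>Basis. (set_coord j r u - set_coord j 0 l) \<bullet> b)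
      = r * (\<Prod>i\<in>UNIV - {j}. u $ i - l $ i)"
    unfolding prod_Basis_cart by (subst prod.remove[of _ j]) auto
  finally have slab_S: "emeasure (slab j r) S = ennreal (\<Prod>i\<in>UNIV - {j}. u $ i - l $ i)"
    using r le by (simp add: ennreal_mult[symmetric] prod_nonneg)
  have "emeasure (distr (slab j r \<Otimes>\<^sub>M lborel) borel (\<lambda>p. set_coord j (snd p) (fst p))) (box l u)
      = emeasure (slab j r \<Otimes>\<^sub>M lborel) (S \<times> {l $ j<..<u $ j})"
    by (subst emeasure_distr) (auto simp: vimage)
  also have "\<dots> = emeasure (slab j r) S * emeasure lborel {l $ j<..<u $ j}"
    by (rule lborel.emeasure_pair_measure_Times) auto
  also have "\<dots> = ennreal ((u $ j - l $ j) * (\<Prod>i\<in>UNIV - {j}. u $ i - l $ i))"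
    using le by (simp add: slab_S ennreal_mult[symmetric] prod_nonneg mult.commute)
  also have "(u $ j - l $ j) * (\<Prod>i\<in>UNIV - {j}. u $ i - l $ i) = (\<Prod>b\<in>Basis. (u - l) \<bullet> b)"
    unfolding prod_Basis_cart by (subst prod.remove[of UNIV j]) auto
  finally show "emeasure (distr (slab j r \<Otimes>\<^sub>M lborel) borel (\<lambda>p. set_coord j (snd p) (fst p))) (box l u)
      = ennreal (\<Prod>b\<in>Basis. (u - l) \<bullet> b)" .
qed simp

definition cube :: "real \<Rightarrow> real^'n \<Rightarrow> (real^'n::finite) set"
  where "cube r x = box x (\<chi> i. x $ i + r)"

lemma mem_cube: "y \<in> cube r x \<longleftrightarrow> (\<forall>i. x $ i < y $ i \<and> y $ i < x $ i + r)"
  by (simp add: cube_def mem_box_cart)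

lemma cube_nonempty: "0 < r \<Longrightarrow> (\<chi> i. x $ i + r / 2) \<in> cube r x"
  by (simp add: mem_cube)

lemma closure_cube: "0 < r \<Longrightarrow> closure (cube r x) = cbox x (\<chi> i. x $ i + r)"
  using cube_nonempty[of r x] unfolding cube_def by (subst closure_box) auto

lemma mem_closure_cube:
  "0 < r \<Longrightarrow> y \<in> closure (cube r x) \<longleftrightarrow> (\<forall>i. x $ i \<le> y $ i \<and> y $ i \<le> x $ i + r)"
  by (simp add: closure_cube mem_box_cart)

lemma open_cube [simp]: "open (cube r x)"
  by (simp add: cube_def open_box)

lemma frontier_cube: "0 < r \<Longrightarrow> frontier (cube r x) = closure (cube r x) - cube r x"
  by (simp add: frontier_def interior_open)

lemma add_mem_cube: "x + z \<in> cube r x \<longleftrightarrow> z \<in> cube r 0"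
  by (simp add: mem_cube)

lemma emeasure_cube: "0 < r \<Longrightarrow> emeasure lborel (cube r (x::real^'n::finite)) = ennreal (r ^ CARD('n))"
proof -
  assume r: "0 < r"
  have "emeasure lborel (cube r x) = ennreal (\<Prod>b\<in>Basis. ((\<chi> i. x $ i + r) - x) \<bullet> b)"
    unfolding cube_def
  proof (rule emeasure_lborel_box)
    fix b :: "real^'n" assume "b \<in> Basis"
    then show "x \<bullet> b \<le> (\<chi> i. x $ i + r) \<bullet> b"
      using r by (auto simp: Basis_vec_def cart_eq_inner_axis[symmetric])
  qed
  then show ?thesis by (simp add: prod_Basis_cart)
qed

text \<open>The form in which \<open>lborel_refill_coordinate\<close> enters the divergence theorem: inside the
  cube, the points of the slab and the new coordinate range over the cube and the edge.\<close>

lemma cube_refill_coordinate: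
  fixes F :: "real^'n::finite \<Rightarrow> 'b::euclidean_space"
  assumes r: "0 < r" and F: "set_integrable lborel (cube r 0) F"
  shows "(LINT z:cube r 0|lborel. F z)
    = (LINT z:cube r 0|lborel. (1 / r) *\<^sub>R (LINT t:{0<..<r}|lborel. F (set_coord j t z)))"
proof -
  interpret slab: sigma_finite_measure "slab j r" using sigma_finite_slab[OF r] .
  interpret pair_sigma_finite "slab j r" lborel ..
  let ?F = "\<lambda>z. indicator (cube r 0) z *\<^sub>R F z"
  let ?c = "\<lambda>p. set_coord j (snd p) (fst p)"
  have int: "integrable lborel ?F" using F by (simp add: set_integrable_def)
  then have meas[measurable]: "?F \<in> borel_measurable borel" by auto
  have "integrable (slab j r \<Otimes>\<^sub>M lborel) (\<lambda>p. ?F (?c p))"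
    using int by (subst (asm) lborel_refill_coordinate[OF r, of j], subst (asm) integrable_distr_eq) auto
  then have "(LINT p|(slab j r \<Otimes>\<^sub>M lborel). ?F (?c p))
      = (LINT z|slab j r. LINT t|lborel. ?F (set_coord j t z))"
    by (subst integral_fst'[symmetric]) auto
  moreover have "(LINT p|(slab j r \<Otimes>\<^sub>M lborel). ?F (?c p)) = integral\<^sup>L lborel ?F"
    by (subst lborel_refill_coordinate[OF r, of j], subst integral_distr) auto
  moreover have "(LINT z|slab j r. LINT t|lborel. ?F (set_coord j t z))
      = (LINT z|lborel. (indicator {0<..<r} (z $ j) / r) *\<^sub>R (LINT t|lborel. ?F (set_coord j t z)))"
    unfolding slab_def using r by (subst integral_density) auto
  moreover have "(indicator {0<..<r} (z $ j) / r) *\<^sub>R (LINT t|lborel. ?F (set_coord j t z))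
    = indicator (cube r 0) z *\<^sub>R (1 / r) *\<^sub>R (LINT t:{0<..<r}|lborel. F (set_coord j t z))" for z :: "real^'n"
  proof -
    have refilled: "indicator {0<..<r} (z $ j) *\<^sub>R ?F (set_coord j t z)
        = indicator (cube r 0) z *\<^sub>R indicator {0<..<r} t *\<^sub>R F (set_coord j t z)" for t
      by (auto simp: indicator_def mem_cube split: if_splits)
    have "indicator {0<..<r} (z $ j) *\<^sub>R (LINT t|lborel. ?F (set_coord j t z))
      = indicator (cube r 0) z *\<^sub>R (LINT t:{0<..<r}|lborel. F (set_coord j t z))"
      unfolding set_lebesgue_integral_def integral_scaleR_right[symmetric]
      by (rule Bochner_Integration.integral_cong[OF refl]) (rule refilled)
    then have "(1 / r) *\<^sub>R indicator {0<..<r} (z $ j) *\<^sub>R (LINT t|lborel. ?F (set_coord j t z))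
      = (1 / r) *\<^sub>R indicator (cube r 0) z *\<^sub>R (LINT t:{0<..<r}|lborel. F (set_coord j t z))" by simp
    then show ?thesis by simp
  qed
  ultimately show ?thesis by (simp only: set_lebesgue_integral_def)
qed

section \<open>Cubes as Green domains\<close>

text \<open>For every \<open>j\<close>, projecting this measure to the facet \<open>z\<^sub>j = 0\<close> gives the \<open>(n - 1)\<close>-dimensional
  measure of that facet: the factor \<open>1 / r\<close> cancels the length of the edges that collapse to points.
  Thus one measure on the open cube describes all facets at once, and no
  lower-dimensional Lebesgue measure is needed.\<close>

definition facet_base :: "real \<Rightarrow> (real^'n::finite) measure"
  where "facet_base r = density (restrict_space lborel (cube r 0)) (\<lambda>_. ennreal (1 / r))"

lemma finite_measure_facet_base:
  assumes r: "0 < r"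
  shows "finite_measure (facet_base r :: (real^'n::finite) measure)"
proof (rule finite_measureI)
  let ?R = "restrict_space lborel (cube r (0::real^'n))"
  have R: "space ?R = cube r 0" by (simp add: space_restrict_space)
  have "cube r 0 \<in> sets ?R" using sets.top[of ?R] unfolding R .
  then have "emeasure (facet_base r) (cube r (0::real^'n)) = ennreal (1 / r) * ennreal (r ^ CARD('n))"
    using r by (simp add: facet_base_def emeasure_density_const emeasure_restrict_space emeasure_cube)
  then show "emeasure (facet_base r) (space (facet_base r :: (real^'n) measure)) \<noteq> \<infinity>"
    using r by (simp add: facet_base_def space_restrict_space ennreal_mult[symmetric])
qed

text \<open>A pair \<open>(j, b)\<close> names a facet of the cube, orthogonal to the \<open>j\<close>-th axis, the upper one if
  \<open>b\<close> holds. Points of the facet are parametrised by the whole cube, via the projection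
  \<open>facet_point\<close>.\<close>

definition facets :: "real \<Rightarrow> (('n::finite \<times> bool) \<times> (real^'n)) measure"
  where "facets r = count_space UNIV \<Otimes>\<^sub>M facet_base r"

definition facet_point :: "real \<Rightarrow> ('n::finite \<times> bool) \<times> (real^'n) \<Rightarrow> real^'n"
  where "facet_point r p = set_coord (fst (fst p)) (if snd (fst p) then r else 0) (snd p)"

definition outward :: "('n::finite \<times> bool) \<times> (real^'n) \<Rightarrow> real^'n"
  where "outward p = (if snd (fst p) then 1 else - 1) *\<^sub>R axis (fst (fst p)) 1"

lemma space_facets: "space (facets r) = UNIV \<times> cube r 0"
  by (simp add: facets_def facet_base_def space_pair_measure space_restrict_space)

lemma measurable_facets:
  fixes f :: "('n::finite \<times> bool) \<times> (real^'n) \<Rightarrow> 'b"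
  assumes "\<And>a. (\<lambda>z. f (a, z)) \<in> measurable borel N"
  shows "f \<in> measurable (facets r) N"
  unfolding facets_def
proof (rule measurable_pair_measure_countable1)
  fix a :: "'n \<times> bool"
  have "(\<lambda>z. f (a, z)) \<in> measurable lborel N"
    using assms[of a] by simp
  then show "(\<lambda>z. f (a, z)) \<in> measurable (facet_base r) N"
    unfolding facet_base_def by (simp add: measurable_restrict_space1)
qed auto

lemma measurable_facet_point [measurable]: "facet_point r \<in> borel_measurable (facets r)"
  by (rule measurable_facets) (simp add: facet_point_def)

lemma measurable_outward [measurable]: "outward \<in> borel_measurable (facets r)"
  by (rule measurable_facets) (simp add: outward_def)

lemma measurable_outward_nth [measurable]: "(\<lambda>s. outward s $ j) \<in> borel_measurable (facets r)"
  by (rule measurable_compose[OF measurable_outward])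
     (intro borel_measurable_continuous_onI continuous_intros)

lemma abs_outward_nth_le: "\<bar>outward s $ j\<bar> \<le> 1"
  by (simp add: outward_def axis_def)

lemma finite_measure_facets:
  assumes r: "0 < r"
  shows "finite_measure (facets r :: (('n::finite \<times> bool) \<times> (real^'n)) measure)"
proof -
  have "finite_measure (facet_base r :: (real^'n) measure)"
    by (rule finite_measure_facet_base[OF r])
  moreover have "finite_measure (count_space (UNIV :: ('n \<times> bool) set))"
    by (intro finite_measure_count_space) simp
  ultimately show ?thesis unfolding facets_def by (intro finite_measure_pair_measure)
qed

lemma integral_facets:
  fixes f :: "('n::finite \<times> bool) \<times> (real^'n) \<Rightarrow> 'b::euclidean_space"
  assumes r: "0 < r" and f: "\<And>a. set_integrable lborel (cube r 0) (\<lambda>z. f (a, z))"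
  shows "integral\<^sup>L (facets r) f = (\<Sum>a\<in>UNIV. (1 / r) *\<^sub>R (LINT z:cube r 0|lborel. f (a, z)))"
proof -
  let ?R = "restrict_space lborel (cube r (0::real^'n))"
  let ?N = "facet_base r :: (real^'n) measure"
  have R: "integrable ?R (\<lambda>z. f (a, z))" for a
    using f[of a] by (subst integrable_restrict_space) (auto simp: set_integrable_def)
  then have meas: "(\<lambda>z. f (a, z)) \<in> borel_measurable ?R" for a by auto
  have N: "integrable ?N (\<lambda>z. f (a, z))" for a
    using R[of a] r unfolding facet_base_def by (subst integrable_density) auto
  interpret N: finite_measure ?N by (rule finite_measure_facet_base[OF r])
  interpret C: sigma_finite_measure "count_space (UNIV :: ('n \<times> bool) set)"
    by (intro sigma_finite_measure_count_space_finite) simp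
  interpret pair_sigma_finite "count_space (UNIV :: ('n \<times> bool) set)" ?N ..
  have "f \<in> borel_measurable (count_space UNIV \<Otimes>\<^sub>M ?N)"
    by (rule measurable_pair_measure_countable1) (use N in auto)
  then have "integrable (count_space UNIV \<Otimes>\<^sub>M ?N) f"
    by (rule Fubini_integrable) (use N in \<open>auto intro!: integrable_count_space\<close>)
  then have "integral\<^sup>L (facets r) f = (\<Sum>a\<in>UNIV. \<integral>z. f (a, z) \<partial>?N)"
    unfolding facets_def by (subst integral_fst'[symmetric]) (auto simp: lebesgue_integral_count_space_finite)
  also have "\<dots> = (\<Sum>a\<in>UNIV. (1 / r) *\<^sub>R (LINT z:cube r 0|lborel. f (a, z)))"
    unfolding facet_base_def using r meas by (subst integral_density)
      (auto simp: integral_restrict_space set_lebesgue_integral_def)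
  finally show ?thesis .
qed

lemma add_set_coord_mem_closure:
  assumes "0 < r" "z \<in> closure (cube r 0)" "0 \<le> t" "t \<le> r"
  shows "x + set_coord j t z \<in> closure (cube r x)"
  using assms by (auto simp: mem_closure_cube)

lemma add_set_coord_mem_cube:
  assumes "z \<in> cube r 0" "0 < t" "t < r"
  shows "x + set_coord j t z \<in> cube r x"
  using assms by (auto simp: mem_cube)

lemma set_integrable_cube:
  fixes f :: "real^'n::finite \<Rightarrow> 'b::euclidean_space"
  assumes r: "0 < r" and "continuous_on (closure (cube r x)) f"
  shows "set_integrable lborel (cube r x) f"
proof (rule set_integrable_subset)
  show "set_integrable lborel (closure (cube r x)) f"
    unfolding set_integrable_def
    using assms by (intro borel_integrable_compact) (auto simp: closure_cube)
qed (auto simp: closure_subset)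

text \<open>The fundamental theorem of calculus on a segment that crosses the cube. The segment meets the
  boundary only at its end points, so differentiability inside the cube suffices.\<close>

lemma integral_along_edge:
  fixes h :: "real^'n::finite \<Rightarrow> 'b::euclidean_space"
  assumes r: "0 < r" and z: "z \<in> cube r 0"
    and h: "continuous_on (closure (cube r x)) h" and g: "continuous_on (closure (cube r x)) g"
    and dh: "\<And>y. y \<in> cube r x \<Longrightarrow> h differentiable (at y)"
    and dg: "\<And>y. y \<in> cube r x \<Longrightarrow> partial_deriv j h y = g y"
  shows "(LINT t:{0<..<r}|lborel. g (x + set_coord j t z))
    = h (x + set_coord j r z) - h (x + set_coord j 0 z)"
proof -
  let ?e = "\<lambda>t. x + set_coord j t z"
  have z': "z \<in> closure (cube r 0)" using z closure_subset by blast
  have cont_e: "continuous_on {0..r} ?e"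
    unfolding set_coord_def by (intro continuous_intros)
  have e: "?e ` {0..r} \<subseteq> closure (cube r x)"
    using r z' by (auto intro!: add_set_coord_mem_closure)
  have "((\<lambda>t. g (?e t)) has_integral h (?e r) - h (?e 0)) {0..r}"
  proof (rule fundamental_theorem_of_calculus_interior)
    show "continuous_on {0..r} (\<lambda>t. h (?e t))"
      by (rule continuous_on_compose2[OF h cont_e e])
    fix t assume "t \<in> {0<..<r}"
    then have mem: "?e t \<in> cube r x" using z by (auto intro: add_set_coord_mem_cube)
    have "(?e has_derivative (\<lambda>s. s *\<^sub>R axis j 1)) (at t)"
      unfolding set_coord_def by (auto intro!: derivative_eq_intros)
    moreover have D: "(h has_derivative frechet_derivative h (at (?e t))) (at (?e t))"
      using dh[OF mem] by (simp add: frechet_derivative_works)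
    ultimately have "((\<lambda>t. h (?e t)) has_derivative
        (\<lambda>s. frechet_derivative h (at (?e t)) (s *\<^sub>R axis j 1))) (at t)"
      by (rule has_derivative_compose)
    moreover have "frechet_derivative h (at (?e t)) (s *\<^sub>R axis j 1) = s *\<^sub>R g (?e t)" for s
      using dg[OF mem] has_derivative_bounded_linear[OF D]
      by (simp add: partial_deriv_def linear_simps)
    ultimately show "((\<lambda>t. h (?e t)) has_vector_derivative g (?e t)) (at t)"
      by (simp add: has_vector_derivative_def)
  qed (use r in simp)
  then have "((\<lambda>t. g (?e t)) has_integral h (?e r) - h (?e 0)) {0<..<r}"
    by (simp add: has_integral_Icc_iff_Ioo)
  moreover have "set_integrable lborel {0<..<r} (\<lambda>t. g (?e t))"
  proof (rule set_integrable_subset)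
    show "set_integrable lborel {0..r} (\<lambda>t. g (?e t))"
      unfolding set_integrable_def
      by (intro borel_integrable_compact continuous_on_compose2[OF g cont_e e]) auto
  qed auto
  ultimately show ?thesis
    by (metis set_borel_integral_eq_integral(2) integral_unique)
qed

text \<open>Refill the \<open>j\<close>-th coordinate on the left and integrate along the edge. This gives the difference
  between the two facets orthogonal to the \<open>j\<close>-th axis; the other facets have \<open>outward s $ j = 0\<close>.
  The vector-valued form serves twice: for scalar functions it shows that cubes are Green
  domains, and it is later applied to a reflected test function.\<close>

lemma cube_divergence_theorem:
  fixes h :: "real^'n::finite \<Rightarrow> 'b::euclidean_space"
  assumes r: "0 < r"
    and h: "continuous_on (closure (cube r x)) h" and g: "continuous_on (closure (cube r x)) g"
    and dh: "\<And>y. y \<in> cube r x \<Longrightarrow> h differentiable (at y)"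
    and dg: "\<And>y. y \<in> cube r x \<Longrightarrow> partial_deriv j h y = g y"
  shows "(LINT z:cube r 0|lborel. g (x + z))
    = (LINT p|facets r. (outward p $ j) *\<^sub>R h (x + facet_point r p))"
proof -
  have shift: "continuous_on (closure (cube r 0)) (\<lambda>z. x + z)"
    by (intro continuous_intros)
  have gx: "continuous_on (closure (cube r 0)) (\<lambda>z. g (x + z))"
    by (rule continuous_on_compose2[OF g shift]) (use r in \<open>auto simp: mem_closure_cube\<close>)
  have hx: "set_integrable lborel (cube r 0) (\<lambda>z. h (x + set_coord k (if b then r else 0) z))" for k b
  proof (rule set_integrable_cube[OF r])
    have "continuous_on (closure (cube r 0)) (\<lambda>z. x + set_coord k (if b then r else 0) z)"
      unfolding set_coord_def by (intro continuous_intros)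
    then show "continuous_on (closure (cube r 0)) (\<lambda>z. h (x + set_coord k (if b then r else 0) z))"
      by (rule continuous_on_compose2[OF h]) (use r in \<open>auto intro!: add_set_coord_mem_closure\<close>)
  qed
  let ?I = "\<lambda>k t. LINT z:cube r 0|lborel. h (x + set_coord k t z)"
  have "(LINT z:cube r 0|lborel. g (x + z))
      = (LINT z:cube r 0|lborel. (1 / r) *\<^sub>R (LINT t:{0<..<r}|lborel. g (x + set_coord j t z)))"
    by (rule cube_refill_coordinate[OF r set_integrable_cube[OF r gx]])
  also have "\<dots> = (LINT z:cube r 0|lborel. (1 / r) *\<^sub>R (h (x + set_coord j r z) - h (x + set_coord j 0 z)))"
    by (rule set_lebesgue_integral_cong)
       (auto simp: integral_along_edge[OF r _ h g dh dg])
  also have "\<dots> = (1 / r) *\<^sub>R (?I j r - ?I j 0)"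
    using hx[of j True] hx[of j False] by (simp add: set_integral_diff)
  also have "\<dots> = (\<Sum>k\<in>UNIV. if k = j then (1 / r) *\<^sub>R (?I j r - ?I j 0) else 0)"
    by simp
  also have "\<dots> = (\<Sum>k\<in>UNIV. \<Sum>b\<in>UNIV. (1 / r) *\<^sub>R
      (LINT z:cube r 0|lborel. (outward ((k, b), z) $ j) *\<^sub>R h (x + facet_point r ((k, b), z))))"
    by (rule sum.cong[OF refl])
       (auto simp: UNIV_bool outward_def facet_point_def axis_def scaleR_diff_right set_lebesgue_integral_def)
  also have "\<dots> = (LINT p|facets r. (outward p $ j) *\<^sub>R h (x + facet_point r p))"
  proof (subst integral_facets[OF r])
    show "set_integrable lborel (cube r 0)
      (\<lambda>z. (outward (a, z) $ j) *\<^sub>R h (x + facet_point r (a, z)))" for a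
      using hx[of "fst a" "snd a"] by (simp add: outward_def facet_point_def)
  qed (simp add: sum.cartesian_product)
  finally show ?thesis .
qed

lemma set_integral_translate_cube:
  fixes f :: "real^'n::finite \<Rightarrow> 'b::euclidean_space"
  assumes "set_borel_measurable borel (cube r x) f"
  shows "(LINT y:cube r x|lborel. f y) = (LINT z:cube r 0|lborel. f (x + z))"
proof -
  have "(LINT y:cube r x|lborel. f y) = (LINT y|distr lborel borel ((+) x). indicator (cube r x) y *\<^sub>R f y)"
    by (simp add: lborel_distr_plus set_lebesgue_integral_def)
  also have "\<dots> = (LINT z|lborel. indicator (cube r x) (x + z) *\<^sub>R f (x + z))"
    using assms unfolding set_borel_measurable_def by (subst integral_distr) auto
  finally show ?thesis by (simp add: set_lebesgue_integral_def indicator_def add_mem_cube)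
qed

definition cube_surface :: "real \<Rightarrow> real^'n \<Rightarrow> (real^'n::finite) measure"
  where "cube_surface r x
    = distr (facets r) (restrict_space borel (frontier (cube r x))) (\<lambda>p. x + facet_point r p)"

text \<open>On the relative interior of a facet exactly one component is nonzero; the lower-dimensional faces
  are null for the surface measure.\<close>

definition cube_normal :: "real \<Rightarrow> real^'n \<Rightarrow> real^'n \<Rightarrow> real^'n::finite"
  where "cube_normal r x y = (\<chi> i. if y $ i = x $ i + r then 1 else if y $ i = x $ i then - 1 else 0)"

text \<open>The cube that parametrises the facets is open, so the projected points avoid the edges; this
  makes the normal unambiguous at them.\<close>

lemma facet_point_mem_frontier:
  assumes "0 < r" "p \<in> space (facets r)"
  shows "x + facet_point r p \<in> frontier (cube r x)"
proof -
  have z: "snd p \<in> cube r 0" using assms(2) by (auto simp: space_facets)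
  then have "snd p \<in> closure (cube r 0)" using closure_subset by blast
  then have "x + facet_point r p \<in> closure (cube r x)"
    unfolding facet_point_def using assms(1) by (intro add_set_coord_mem_closure) auto
  moreover have "x + facet_point r p \<notin> cube r x"
    by (auto simp: mem_cube facet_point_def intro!: exI[of _ "fst (fst p)"])
  ultimately show ?thesis using assms(1) by (simp add: frontier_cube)
qed

lemma measurable_to_frontier:
  assumes "0 < r"
  shows "(\<lambda>p. x + facet_point r p) \<in> measurable (facets r) (restrict_space borel (frontier (cube r x)))"
  by (intro measurable_restrict_space2) (use assms in \<open>auto intro: facet_point_mem_frontier\<close>)

lemma cube_normal_facet_point:
  assumes "0 < r" "p \<in> space (facets r)"
  shows "cube_normal r x (x + facet_point r p) = outward p"
proof -
  have "0 < snd p $ i \<and> snd p $ i < r" for i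
    using assms(2) by (auto simp: space_facets mem_cube)
  then have "snd p $ i \<noteq> 0 \<and> snd p $ i \<noteq> r" for i
    by (metis less_irrefl)
  then show ?thesis
    using assms(1) by (auto simp: cube_normal_def vec_eq_iff facet_point_def outward_def axis_def)
qed

lemma green_data_cube:
  fixes x :: "real^'n::finite"
  assumes r: "0 < r"
  shows "green_data (cube r x) (cube_surface r x) (cube_normal r x)"
  unfolding green_data_def
proof (intro conjI allI impI)
  let ?F = "restrict_space borel (frontier (cube r x))"
  note to_F = measurable_to_frontier[OF r, of x]
  show "sets (cube_surface r x) = sets ?F" by (simp add: cube_surface_def)
  show "finite_measure (cube_surface r x)"
    unfolding cube_surface_def
    by (rule finite_measure.finite_measure_distr[OF finite_measure_facets[OF r] to_F])
  have normal: "cube_normal r x \<in> borel_measurable borel"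
  proof (subst borel_measurable_euclidean_space, intro ballI)
    fix b :: "real^'n" assume "b \<in> Basis"
    then obtain i where b: "b = axis i 1" by (auto simp: Basis_vec_def)
    have [measurable]: "(\<lambda>y. y $ i) \<in> borel_measurable borel"
      by (intro borel_measurable_continuous_onI continuous_intros)
    show "(\<lambda>y. cube_normal r x y \<bullet> b) \<in> borel_measurable borel"
      unfolding b cart_eq_inner_axis[symmetric] cube_normal_def vec_lambda_beta by measurable
  qed
  then have normal_F: "cube_normal r x \<in> borel_measurable ?F"
    by (rule measurable_restrict_space1)
  then show "cube_normal r x \<in> borel_measurable (cube_surface r x)"
    by (simp add: cube_surface_def)
  show "AE y in cube_surface r x. norm (cube_normal r x y) = 1"
    unfolding cube_surface_def
  proof (subst AE_distr_iff[OF to_F])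
    show "{y \<in> space ?F. norm (cube_normal r x y) = 1} \<in> sets ?F"
      using normal_F by measurable
    show "AE p in facets r. norm (cube_normal r x (x + facet_point r p)) = 1"
      by (intro AE_I2) (auto simp: cube_normal_facet_point[OF r] outward_def)
  qed
  fix \<phi> :: "real^'n \<Rightarrow> real" and j :: 'n
  assume \<phi>: "C1_closure \<phi> (cube r x)"
  then obtain g where g: "continuous_on (closure (cube r x)) g"
    and gj: "\<And>y. y \<in> cube r x \<Longrightarrow> g y = partial_deriv j \<phi> y"
    unfolding C1_closure_def by blast
  have cont: "continuous_on (closure (cube r x)) \<phi>" and "\<phi> differentiable_on cube r x"
    using \<phi> by (auto simp: C1_closure_def)
  then have diff: "\<phi> differentiable (at y)" if "y \<in> cube r x" for y
    using that by (simp add: differentiable_on_eq_differentiable_at)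
  have "\<phi> \<in> borel_measurable ?F"
    using r by (intro borel_measurable_continuous_on_restrict continuous_on_subset[OF cont]) (simp add: frontier_cube)
  moreover have "(\<lambda>y. cube_normal r x y $ j) \<in> borel_measurable ?F"
    using normal_F by (rule measurable_compose) (intro borel_measurable_continuous_onI continuous_intros)
  ultimately have "(LINT y|cube_surface r x. cube_normal r x y $ j * \<phi> y)
      = (LINT p|facets r. cube_normal r x (x + facet_point r p) $ j * \<phi> (x + facet_point r p))"
    unfolding cube_surface_def by (subst integral_distr[OF to_F]) auto
  also have "\<dots> = (LINT p|facets r. (outward p $ j) *\<^sub>R \<phi> (x + facet_point r p))"
    by (intro Bochner_Integration.integral_cong) (auto simp: cube_normal_facet_point[OF r])
  also have "\<dots> = (LINT z:cube r 0|lborel. g (x + z))"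
    using cube_divergence_theorem[OF r cont g diff, of j] gj by simp
  also have "\<dots> = (LINT y:cube r x|lborel. g y)"
    using set_integrable_cube[OF r g]
    by (subst set_integral_translate_cube) (auto simp: set_borel_measurable_def set_integrable_def)
  also have "\<dots> = (LINT y:cube r x|lborel. partial_deriv j \<phi> y)"
    by (rule set_lebesgue_integral_cong) (auto simp: gj)
  finally show "(LINT y:cube r x|lborel. partial_deriv j \<phi> y)
    = (LINT y|cube_surface r x. cube_normal r x y $ j * \<phi> y)" by simp
qed

lemma green_domain_cube: "0 < r \<Longrightarrow> green_domain (cube r x)"
  using green_data_cube[of r x] unfolding green_domain_def
  by (auto simp: cube_def bounded_box open_box convex_box intro: convex_connected)

section \<open>Averages over translates\<close>

text \<open>For \<open>p < \<infinity>\<close> this is the pointwise bound \<open>t \<le> 1 + t\<^sup>p\<close>, valid because \<open>p \<ge> 1\<close>.\<close>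

lemma in_Lp_imp_set_integrable:
  fixes f :: "'a \<Rightarrow> 'b::euclidean_space"
  assumes p: "1 \<le> p" and f: "in_Lp p M f" and K[measurable]: "K \<in> sets M" "emeasure M K < \<infinity>"
  shows "set_integrable M K f"
proof -
  have [measurable]: "f \<in> borel_measurable M" using f by (simp add: in_Lp_def)
  have one: "integrable M (\<lambda>x. indicator K x :: real)"
    using K by (simp add: integrable_indicator_iff)
  show ?thesis
  proof (cases "p = \<infinity>")
    case True
    then obtain C where "AE x in M. norm (f x) \<le> C"
      using f by (auto simp: in_Lp_def)
    moreover have "integrable M (\<lambda>x. C * indicator K x)" using one by simp
    ultimately show ?thesis unfolding set_integrable_def
      by - (rule Bochner_Integration.integrable_bound[where f = "\<lambda>x. C * indicator K x"],
        auto split: split_indicator elim!: eventually_mono)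
  next
    case False
    let ?q = "enn2real p"
    have "1 \<le> ?q"
      using p False by (metis enn2real_1 enn2real_mono infinity_ennreal_def less_top)
    have bound: "t \<le> 1 + t powr ?q" if "0 \<le> t" for t :: real
    proof (cases "t \<le> 1")
      case False
      then have "t powr 1 \<le> t powr ?q" using \<open>1 \<le> ?q\<close> by (intro powr_mono) auto
      then show ?thesis using False by simp
    qed (smt (verit) powr_ge_zero)
    have "integrable M (\<lambda>x. indicator K x + norm (f x) powr ?q)"
      using f False one by (auto simp: in_Lp_def)
    then show ?thesis unfolding set_integrable_def
    proof (rule Bochner_Integration.integrable_bound)
      have "norm (indicator K x *\<^sub>R f x) \<le> norm (indicator K x + norm (f x) powr ?q)" for x
        using bound[of "norm (f x)"] by (auto split: split_indicator)
      then show "AE x in M. norm (indicator K x *\<^sub>R f x) \<le> norm (indicator K x + norm (f x) powr ?q)"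
        by simp
    qed simp
  qed
qed

lemma nn_integral_translates:
  fixes w :: "'a::euclidean_space \<Rightarrow> ennreal"
  assumes "finite_measure \<mu>" and q[measurable]: "q \<in> borel_measurable \<mu>"
    and w[measurable]: "w \<in> borel_measurable borel"
  shows "(\<integral>\<^sup>+x. \<integral>\<^sup>+s. w (x + q s) \<partial>\<mu> \<partial>lborel) = (\<integral>\<^sup>+y. w y \<partial>lborel) * emeasure \<mu> (space \<mu>)"
proof -
  interpret finite_measure \<mu> by fact
  interpret pair_sigma_finite lborel \<mu> ..
  have "(\<integral>\<^sup>+x. \<integral>\<^sup>+s. w (x + q s) \<partial>\<mu> \<partial>lborel) = (\<integral>\<^sup>+s. \<integral>\<^sup>+x. w (x + q s) \<partial>lborel \<partial>\<mu>)"
    by (rule Fubini'[symmetric]) measurable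
  moreover have translate: "(\<integral>\<^sup>+x. w (x + q s) \<partial>lborel) = (\<integral>\<^sup>+y. w y \<partial>lborel)" for s
  proof -
    have "(\<integral>\<^sup>+y. w y \<partial>lborel) = (\<integral>\<^sup>+y. w y \<partial>distr lborel borel ((+) (q s)))"
      by (simp add: lborel_distr_plus)
    then show ?thesis by (simp add: nn_integral_distr add.commute)
  qed
  ultimately show ?thesis by (simp only: translate nn_integral_const)
qed

text \<open>Averaged over all positions \<open>x\<close> in a ball, the surface integral of the function \<open>\<rho>\<close> that witnesses
  exceptionality is at most the total surface area times the integral of \<open>\<rho>\<close> over a larger ball,
  which is finite because \<open>\<rho>\<close> is locally integrable. So for almost every position the surface integral
  of \<open>\<rho>\<close> is finite.\<close>

lemma AE_cube_not_exceptional: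
  assumes r: "0 < r" and p: "1 \<le> p" and "p_exceptional p \<E>"
  shows "AE x in lborel. cube r (x::real^'n::finite) \<notin> \<E>"
proof -
  obtain \<rho> :: "real^'n \<Rightarrow> ennreal" where [measurable]: "\<rho> \<in> borel_measurable borel"
    and \<rho>: "in_Lp_ennreal p lborel \<rho>"
    and inf: "\<And>U \<sigma> \<nu>. U \<in> \<E> \<Longrightarrow> green_data U \<sigma> \<nu> \<Longrightarrow> (\<integral>\<^sup>+x. \<rho> x \<partial>\<sigma>) = \<infinity>"
    using assms(3) unfolding p_exceptional_def by blast
  interpret finite_measure "facets r" by (rule finite_measure_facets[OF r])
  have surface: "(\<integral>\<^sup>+y. \<rho> y \<partial>cube_surface r x) = (\<integral>\<^sup>+s. \<rho> (x + facet_point r s) \<partial>facets r)" for x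
    unfolding cube_surface_def
    by (rule nn_integral_distr[OF measurable_to_frontier[OF r]]) (simp add: measurable_restrict_space1)
  have "bounded (closure (cube r (0::real^'n)))" by (simp add: closure_cube[OF r])
  then obtain L where L: "\<And>z. z \<in> closure (cube r (0::real^'n)) \<Longrightarrow> norm z \<le> L"
    by (auto simp: bounded_iff)
  \<comment> \<open>Facet points lie in a fixed bounded set, so a translate of the boundary with corner in a ball
    stays in a larger ball.\<close>
  have fp: "norm (facet_point r s) \<le> L" if "s \<in> space (facets r :: (('n \<times> bool) \<times> (real^'n)) measure)" for s
    using L[of "facet_point r s"] facet_point_mem_frontier[OF r that, of 0] by (simp add: frontier_cube[OF r])
  have "AE x in lborel. norm x < real N \<longrightarrow> cube r (x::real^'n) \<notin> \<E>" for N
  proof -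
    let ?K = "cball (0::real^'n) (real N + L)"
    define w where "w y = \<rho> y * indicator ?K y" for y
    have [measurable]: "w \<in> borel_measurable borel"
      unfolding w_def by (intro borel_measurable_times_ennreal borel_measurable_indicator) auto
    have "(\<integral>\<^sup>+y. w y \<partial>lborel) < \<infinity>"
    proof -
      have "set_integrable lborel ?K (\<lambda>x. enn2real (\<rho> x))"
        using \<rho> p by (intro in_Lp_imp_set_integrable) (auto simp: in_Lp_ennreal_def emeasure_bounded_finite[unfolded infinity_ennreal_def])
      then have "(\<integral>\<^sup>+y. ennreal (norm (indicator ?K y *\<^sub>R enn2real (\<rho> y))) \<partial>lborel) < \<infinity>"
        unfolding set_integrable_def by (simp add: integrable_iff_bounded)
      moreover have "(\<integral>\<^sup>+y. w y \<partial>lborel) = (\<integral>\<^sup>+y. ennreal (norm (indicator ?K y *\<^sub>R enn2real (\<rho> y))) \<partial>lborel)"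
      proof (rule nn_integral_cong_AE)
        have "AE y in lborel. \<rho> y \<noteq> \<infinity>" using \<rho> by (simp add: in_Lp_ennreal_def)
        then show "AE y in lborel. w y = ennreal (norm (indicator ?K y *\<^sub>R enn2real (\<rho> y)))"
          by eventually_elim (auto split: split_indicator simp: less_top w_def)
      qed
      ultimately show ?thesis by simp
    qed
    then have "(\<integral>\<^sup>+x. \<integral>\<^sup>+s. w (x + facet_point r s) \<partial>facets r \<partial>lborel) \<noteq> \<infinity>"
      using emeasure_finite[of "space (facets r)"]
      by (subst nn_integral_translates[OF finite_measure_facets[OF r] measurable_facet_point])
         (auto simp: ennreal_mult_eq_top_iff)
    then have "AE x in lborel. (\<integral>\<^sup>+s. w (x + facet_point r s) \<partial>facets r) \<noteq> \<infinity>"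
      by (intro nn_integral_PInf_AE) measurable
    then show ?thesis
    proof eventually_elim
      case (elim x)
      show ?case
      proof (intro impI notI)
        assume x: "norm x < real N" and E: "cube r x \<in> \<E>"
        have "(\<integral>\<^sup>+s. w (x + facet_point r s) \<partial>facets r) = (\<integral>\<^sup>+s. \<rho> (x + facet_point r s) \<partial>facets r)"
        proof (rule nn_integral_cong)
          fix s assume "s \<in> space (facets r :: (('n \<times> bool) \<times> (real^'n)) measure)"
          then have "norm (x + facet_point r s) \<le> real N + L"
            using fp[of s] x norm_triangle_ineq[of x "facet_point r s"] by simp
          then show "w (x + facet_point r s) = \<rho> (x + facet_point r s)" by (simp add: w_def)
        qed
        then show False using elim inf[OF E green_data_cube[OF r]] surface by simp
      qed
    qed
  qed
  then have "AE x in lborel. \<forall>N. norm x < real N \<longrightarrow> cube r (x::real^'n) \<notin> \<E>"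
    unfolding AE_all_countable by blast
  then show ?thesis
    by eventually_elim (metis reals_Archimedean2)
qed

lemma integrable_translates:
  fixes v :: "'a::euclidean_space \<Rightarrow> 'b::euclidean_space" and k :: "'s \<Rightarrow> real"
  assumes "finite_measure \<mu>" and q[measurable]: "q \<in> borel_measurable \<mu>"
    and k[measurable]: "k \<in> borel_measurable \<mu>" and C: "\<And>s. \<bar>k s\<bar> \<le> C"
    and v: "integrable lborel v"
  shows "integrable (lborel \<Otimes>\<^sub>M \<mu>) (\<lambda>(x, s). k s *\<^sub>R v (x + q s))"
proof (rule integrableI_bounded)
  interpret finite_measure \<mu> by fact
  have [measurable]: "v \<in> borel_measurable borel" using v by auto
  show "(\<lambda>(x, s). k s *\<^sub>R v (x + q s)) \<in> borel_measurable (lborel \<Otimes>\<^sub>M \<mu>)" by measurable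
  have "(\<integral>\<^sup>+y. norm (case y of (x, s) \<Rightarrow> k s *\<^sub>R v (x + q s)) \<partial>(lborel \<Otimes>\<^sub>M \<mu>))
      = (\<integral>\<^sup>+x. \<integral>\<^sup>+s. norm (k s *\<^sub>R v (x + q s)) \<partial>\<mu> \<partial>lborel)"
    by (subst nn_integral_fst[symmetric]) auto
  also have "\<dots> \<le> (\<integral>\<^sup>+x. \<integral>\<^sup>+s. ennreal C * ennreal (norm (v (x + q s))) \<partial>\<mu> \<partial>lborel)"
  proof (intro nn_integral_mono)
    fix x :: 'a and s
    have "0 \<le> C" using C[of s] by linarith
    then show "ennreal (norm (k s *\<^sub>R v (x + q s))) \<le> ennreal C * ennreal (norm (v (x + q s)))"
      by (simp add: ennreal_mult[symmetric] C mult_right_mono)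
  qed
  also have "\<dots> = ennreal C * ((\<integral>\<^sup>+y. norm (v y) \<partial>lborel) * emeasure \<mu> (space \<mu>))"
    by (simp add: nn_integral_cmult nn_integral_translates[OF assms(1) q, of "\<lambda>y. ennreal (norm (v y))"])
  also have "\<dots> < \<infinity>"
  proof -
    have "emeasure \<mu> (space \<mu>) < top" by (simp add: less_top[symmetric] emeasure_finite)
    moreover have "(\<integral>\<^sup>+y. norm (v y) \<partial>lborel) < top" using v by (simp add: integrable_iff_bounded)
    ultimately show ?thesis by (simp add: ennreal_mult_less_top)
  qed
  finally show "(\<integral>\<^sup>+y. norm (case y of (x, s) \<Rightarrow> k s *\<^sub>R v (x + q s)) \<partial>(lborel \<Otimes>\<^sub>M \<mu>)) < \<infinity>" .
qed

lemma AE_integrable_translates: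
  fixes v :: "'a::euclidean_space \<Rightarrow> 'b::euclidean_space" and k :: "'s \<Rightarrow> real"
  assumes "finite_measure \<mu>" "q \<in> borel_measurable \<mu>" "k \<in> borel_measurable \<mu>"
    and "\<And>s. \<bar>k s\<bar> \<le> C" "integrable lborel v"
  shows "AE x in lborel. integrable \<mu> (\<lambda>s. k s *\<^sub>R v (x + q s))"
proof -
  interpret finite_measure \<mu> by fact
  interpret pair_sigma_finite lborel \<mu> ..
  show ?thesis by (rule AE_integrable_fst[OF integrable_translates[OF assms]])
qed

text \<open>The operator that averages \<open>v\<close> over the translates \<open>x + q s\<close> with weight \<open>k\<close> has as its adjoint the
  averaging over \<open>y - q s\<close>; this is Fubini's theorem and translation invariance. In the application
  \<open>v\<close> is merely integrable and \<open>\<psi>\<close> is a test function, so that averages of a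
  rough function become averages of a smooth one.\<close>

lemma averaging_adjoint:
  fixes v \<psi> :: "'a::euclidean_space \<Rightarrow> 'b::euclidean_space" and k :: "'s \<Rightarrow> real"
  assumes \<mu>: "finite_measure \<mu>" and q[measurable]: "q \<in> borel_measurable \<mu>"
    and k[measurable]: "k \<in> borel_measurable \<mu>" and C: "\<And>s. \<bar>k s\<bar> \<le> C"
    and v: "integrable lborel v"
    and \<psi>[measurable]: "\<psi> \<in> borel_measurable borel" and D: "\<And>x. norm (\<psi> x) \<le> D"
  shows "integrable lborel (\<lambda>x. \<psi> x \<bullet> (\<integral>s. k s *\<^sub>R v (x + q s) \<partial>\<mu>))"
    and "integrable lborel (\<lambda>y. v y \<bullet> (\<integral>s. k s *\<^sub>R \<psi> (y - q s) \<partial>\<mu>))"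
    and "(\<integral>x. \<psi> x \<bullet> (\<integral>s. k s *\<^sub>R v (x + q s) \<partial>\<mu>) \<partial>lborel)
      = (\<integral>y. v y \<bullet> (\<integral>s. k s *\<^sub>R \<psi> (y - q s) \<partial>\<mu>) \<partial>lborel)"
proof -
  interpret finite_measure \<mu> by fact
  interpret pair_sigma_finite lborel \<mu> ..
  have [measurable]: "v \<in> borel_measurable borel" using v by auto
  have "0 \<le> D" using D[of 0] norm_ge_zero order_trans by blast
  note int_v = integrable_translates[OF \<mu> q k C v]
  have H: "integrable (lborel \<Otimes>\<^sub>M \<mu>) (\<lambda>(x, s). \<psi> x \<bullet> (k s *\<^sub>R v (x + q s)))"
  proof (rule Bochner_Integration.integrable_bound)
    show "integrable (lborel \<Otimes>\<^sub>M \<mu>) (\<lambda>z. D * norm (case z of (x, s) \<Rightarrow> k s *\<^sub>R v (x + q s)))"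
      using int_v by (intro integrable_mult_right integrable_norm)
    have "norm (\<psi> x \<bullet> (k s *\<^sub>R v (x + q s))) \<le> norm (D * norm (k s *\<^sub>R v (x + q s)))" for x s
      using order_trans[OF Cauchy_Schwarz_ineq2 mult_right_mono[OF D[of x] norm_ge_zero]] \<open>0 \<le> D\<close>
      by (metis abs_of_nonneg mult_nonneg_nonneg norm_ge_zero real_norm_def)
    then show "AE z in lborel \<Otimes>\<^sub>M \<mu>. norm (case z of (x, s) \<Rightarrow> \<psi> x \<bullet> (k s *\<^sub>R v (x + q s)))
        \<le> norm (D * norm (case z of (x, s) \<Rightarrow> k s *\<^sub>R v (x + q s)))"
      by (intro AE_I2) (auto split: prod.split)
  qed measurable
  have inner: "AE x in lborel. (\<integral>s. \<psi> x \<bullet> (k s *\<^sub>R v (x + q s)) \<partial>\<mu>) = \<psi> x \<bullet> (\<integral>s. k s *\<^sub>R v (x + q s) \<partial>\<mu>)"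
    using AE_integrable_translates[OF \<mu> q k C v] by eventually_elim (rule integral_inner_right, simp)
  show "integrable lborel (\<lambda>x. \<psi> x \<bullet> (\<integral>s. k s *\<^sub>R v (x + q s) \<partial>\<mu>))"
    by (rule integrable_cong_AE_imp[OF integrable_fst[OF H]]) (use inner in auto)
  let ?G = "\<lambda>y s. v y \<bullet> (k s *\<^sub>R \<psi> (y - q s))"
  have \<psi>k: "norm (k s *\<^sub>R \<psi> (y - q s)) \<le> C * D" for s y
    using mult_mono[OF C[of s] D[of "y - q s"]] C[of s] by simp
  have G: "integrable (lborel \<Otimes>\<^sub>M \<mu>) (\<lambda>(y, s). ?G y s)"
  proof (rule Bochner_Integration.integrable_bound)
    have "integrable (lborel \<Otimes>\<^sub>M \<mu>) (\<lambda>(x, s). 1 *\<^sub>R v (x + 0))"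
      by (rule integrable_translates[OF \<mu>, of _ _ 1]) (use v in auto)
    then show "integrable (lborel \<Otimes>\<^sub>M \<mu>) (\<lambda>z. norm (case z of (x, s) \<Rightarrow> 1 *\<^sub>R v (x + 0)) * (C * D))"
      by (intro integrable_mult_left integrable_norm)
    have "norm (?G y s) \<le> norm (norm (v y) * (C * D))" for y s
      using order_trans[OF Cauchy_Schwarz_ineq2 mult_left_mono[OF \<psi>k norm_ge_zero]]
      by (metis abs_ge_self order_trans real_norm_def)
    then show "AE z in lborel \<Otimes>\<^sub>M \<mu>. norm (case z of (y, s) \<Rightarrow> ?G y s)
        \<le> norm (norm (case z of (x, s) \<Rightarrow> 1 *\<^sub>R v (x + 0)) * (C * D))"
      by (intro AE_I2) (auto split: prod.split)
  qed measurable
  have G_inner: "(\<integral>s. ?G y s \<partial>\<mu>) = v y \<bullet> (\<integral>s. k s *\<^sub>R \<psi> (y - q s) \<partial>\<mu>)" for y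
    by (rule integral_inner_right) (intro integrable_const_bound[where B = "C * D"] AE_I2 \<psi>k, measurable)
  show "integrable lborel (\<lambda>y. v y \<bullet> (\<integral>s. k s *\<^sub>R \<psi> (y - q s) \<partial>\<mu>))"
    using integrable_fst[OF G] unfolding G_inner .
  have translate: "(\<integral>x. \<psi> x \<bullet> (k s *\<^sub>R v (x + q s)) \<partial>lborel) = (\<integral>y. ?G y s \<partial>lborel)" for s
  proof -
    have "(\<integral>y. ?G y s \<partial>lborel) = (\<integral>y. ?G y s \<partial>distr lborel borel ((+) (q s)))"
      by (simp add: lborel_distr_plus)
    also have "\<dots> = (\<integral>x. ?G (q s + x) s \<partial>lborel)"
      by (rule integral_distr) auto
    also have "\<dots> = (\<integral>x. \<psi> x \<bullet> (k s *\<^sub>R v (x + q s)) \<partial>lborel)"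
      by (rule Bochner_Integration.integral_cong[OF refl]) (simp add: add.commute inner_commute)
    finally show ?thesis by (rule sym)
  qed
  have "(\<integral>x. \<psi> x \<bullet> (\<integral>s. k s *\<^sub>R v (x + q s) \<partial>\<mu>) \<partial>lborel)
      = (\<integral>x. \<integral>s. \<psi> x \<bullet> (k s *\<^sub>R v (x + q s)) \<partial>\<mu> \<partial>lborel)"
    by (rule integral_cong_AE) (use inner in auto)
  also have "\<dots> = (\<integral>s. \<integral>x. \<psi> x \<bullet> (k s *\<^sub>R v (x + q s)) \<partial>lborel \<partial>\<mu>)"
    by (rule Fubini_integral[OF H, symmetric])
  also have "\<dots> = (\<integral>s. \<integral>y. ?G y s \<partial>lborel \<partial>\<mu>)"
    unfolding translate ..
  also have "\<dots> = (\<integral>y. \<integral>s. ?G y s \<partial>\<mu> \<partial>lborel)"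
    by (rule Fubini_integral[OF G])
  finally show "(\<integral>x. \<psi> x \<bullet> (\<integral>s. k s *\<^sub>R v (x + q s) \<partial>\<mu>) \<partial>lborel)
      = (\<integral>y. v y \<bullet> (\<integral>s. k s *\<^sub>R \<psi> (y - q s) \<partial>\<mu>) \<partial>lborel)"
    unfolding G_inner .
qed

section \<open>Shrinking the cubes\<close>

definition cube_mean :: "real \<Rightarrow> (real^'n::finite \<Rightarrow> 'b::euclidean_space) \<Rightarrow> real^'n \<Rightarrow> 'b"
  where "cube_mean r \<eta> y = (1 / r ^ CARD('n)) *\<^sub>R (LINT z:cube r 0|lborel. \<eta> (y - z))"

lemma norm_closure_cube:
  fixes z :: "real^'n::finite"
  assumes "0 < r" "z \<in> closure (cube r 0)"
  shows "norm z \<le> real CARD('n) * r"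
proof -
  have "norm z \<le> (\<Sum>i\<in>UNIV. \<bar>z $ i\<bar>)" by (rule norm_le_l1_cart)
  also have "\<dots> \<le> (\<Sum>i\<in>(UNIV::'n set). r)"
    using assms by (intro sum_mono) (auto simp: mem_closure_cube)
  finally show ?thesis by simp
qed

lemma norm_cube_integral_le:
  fixes f :: "real^'n::finite \<Rightarrow> 'b::euclidean_space"
  assumes r: "0 < r" and f: "set_integrable lborel (cube r 0) f"
    and e: "\<And>z. z \<in> cube r 0 \<Longrightarrow> norm (f z) \<le> e"
  shows "norm ((1 / r ^ CARD('n)) *\<^sub>R (LINT z:cube r 0|lborel. f z)) \<le> e"
proof -
  have const: "set_integrable lborel (cube r (0::real^'n)) (\<lambda>_. c)" for c :: real
    by (rule set_integrable_cube[OF r]) simp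
  have "norm (LINT z:cube r 0|lborel. f z) \<le> (LINT z:cube r 0|lborel. norm (f z))"
    by (rule set_integral_norm_bound[OF f])
  also have "\<dots> \<le> (LINT z:cube r (0::real^'n)|lborel. e)"
    by (rule set_integral_mono[OF set_integrable_norm[OF f] const e])
  also have "\<dots> = e * r ^ CARD('n)"
    using r by (simp add: set_lebesgue_integral_def measure_def emeasure_cube)
  finally show ?thesis using r by (simp add: field_simps)
qed

lemma set_integrable_cube_reflected:
  fixes \<eta> :: "real^'n::finite \<Rightarrow> 'b::euclidean_space"
  assumes r: "0 < r" and \<eta>: "continuous_on UNIV \<eta>"
  shows "set_integrable lborel (cube r x) (\<lambda>z. \<eta> (y - z))"
  by (rule set_integrable_cube[OF r]) (auto intro!: continuous_intros continuous_on_compose2[OF \<eta>])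

lemma cube_mean_tendsto:
  fixes \<eta> :: "real^'n::finite \<Rightarrow> 'b::euclidean_space"
  assumes \<eta>: "continuous_on UNIV \<eta>"
  shows "((\<lambda>r. cube_mean r \<eta> y) \<longlongrightarrow> \<eta> y) (at_right 0)"
proof (rule tendstoI)
  fix e :: real assume "0 < e"
  then obtain d where d: "0 < d" "\<And>x. dist x y < d \<Longrightarrow> dist (\<eta> x) (\<eta> y) < e / 2"
    using \<eta> by (metis UNIV_I continuous_on_iff half_gt_zero)
  have "eventually (\<lambda>r::real. 0 < r \<and> r < d / CARD('n)) (at_right 0)"
    using d by (intro eventually_conj eventually_at_right_less eventually_at_rightI[of 0 "d / CARD('n)"]) auto
  then show "\<forall>\<^sub>F r in at_right 0. dist (cube_mean r \<eta> y) (\<eta> y) < e"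
  proof eventually_elim
    case (elim r)
    then have r: "0 < r" and rd: "real CARD('n) * r < d" by (auto simp: field_simps)
    have const: "set_integrable lborel (cube r (0::real^'n)) (\<lambda>_. \<eta> y)"
      by (rule set_integrable_cube[OF r]) simp
    have "(LINT z:cube r (0::real^'n)|lborel. \<eta> y) = r ^ CARD('n) *\<^sub>R \<eta> y"
      using r by (simp add: set_lebesgue_integral_def measure_def emeasure_cube less_top[symmetric])
    then have "cube_mean r \<eta> y - \<eta> y
        = (1 / r ^ CARD('n)) *\<^sub>R (LINT z:cube r 0|lborel. \<eta> (y - z) - \<eta> y)"
      using r by (simp add: cube_mean_def set_integral_diff[OF set_integrable_cube_reflected[OF r \<eta>] const]
        scaleR_diff_right)
    also have "norm \<dots> \<le> e / 2"
    proof (rule norm_cube_integral_le[OF r set_integral_diff(1)[OF set_integrable_cube_reflected[OF r \<eta>] const]])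
      fix z :: "real^'n" assume "z \<in> cube r 0"
      then have "norm z < d"
        using norm_closure_cube[OF r, of z] closure_subset rd by fastforce
      then show "norm (\<eta> (y - z) - \<eta> y) \<le> e / 2"
        using d(2)[of "y - z"] by (simp add: dist_norm)
    qed
    finally show ?case using \<open>0 < e\<close> by (simp add: dist_norm)
  qed
qed

text \<open>Measurability of the integrands is assumed because in the application it comes for free, from
  the integrability statement of \<open>averaging_adjoint\<close>.\<close>

lemma integral_cube_mean_tendsto:
  fixes v \<eta> :: "real^'n::finite \<Rightarrow> 'b::euclidean_space"
  assumes v: "integrable lborel v" and \<eta>: "continuous_on UNIV \<eta>" and D: "\<And>x. norm (\<eta> x) \<le> D"
    and \<rho>: "\<And>N. 0 < \<rho> N" "\<rho> \<longlonglongrightarrow> 0"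
    and meas: "\<And>N. (\<lambda>y. v y \<bullet> cube_mean (\<rho> N) \<eta> y) \<in> borel_measurable borel"
  shows "(\<lambda>N. \<integral>y. v y \<bullet> cube_mean (\<rho> N) \<eta> y \<partial>lborel) \<longlonglongrightarrow> (\<integral>y. v y \<bullet> \<eta> y \<partial>lborel)"
proof (rule integral_dominated_convergence)
  have \<rho>0: "filterlim \<rho> (at_right 0) sequentially"
    using \<rho> by (auto simp: filterlim_at intro!: always_eventually less_imp_neq[symmetric])
  have "(\<lambda>N. v y \<bullet> cube_mean (\<rho> N) \<eta> y) \<longlonglongrightarrow> v y \<bullet> \<eta> y" for y
    by (intro tendsto_intros filterlim_compose[OF cube_mean_tendsto[OF \<eta>] \<rho>0])
  then show "AE y in lborel. (\<lambda>N. v y \<bullet> cube_mean (\<rho> N) \<eta> y) \<longlonglongrightarrow> v y \<bullet> \<eta> y" by simp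
  show "integrable lborel (\<lambda>y. norm (v y) * D)" using v by simp
  fix N
  have "norm (cube_mean (\<rho> N) \<eta> y) \<le> D" for y
    unfolding cube_mean_def
    by (rule norm_cube_integral_le[OF \<rho>(1) set_integrable_cube_reflected[OF \<rho>(1) \<eta>] D])
  then show "AE y in lborel. norm (v y \<bullet> cube_mean (\<rho> N) \<eta> y) \<le> norm (v y) * D"
    by (auto intro!: AE_I2 order_trans[OF Cauchy_Schwarz_ineq2] mult_left_mono)
  show "(\<lambda>y. v y \<bullet> cube_mean (\<rho> N) \<eta> y) \<in> borel_measurable lborel" using meas by simp
qed (use v borel_measurable_continuous_onI[OF \<eta>] in \<open>auto intro!: borel_measurable_inner\<close>)

lemma partial_deriv_reflected:
  fixes \<psi> :: "real^'n::finite \<Rightarrow> 'b::real_normed_vector"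
  assumes "\<And>x. \<psi> differentiable (at x)"
  shows "(\<lambda>z. \<psi> (y - z)) differentiable (at z)"
    and "partial_deriv j (\<lambda>z. \<psi> (y - z)) z = - partial_deriv j \<psi> (y - z)"
proof -
  let ?D = "frechet_derivative \<psi> (at (y - z))"
  have D: "(\<psi> has_derivative ?D) (at (y - z))"
    using assms by (simp add: frechet_derivative_works)
  have "((\<lambda>z. y - z) has_derivative (\<lambda>h. - h)) (at z)"
    by (auto intro!: derivative_eq_intros)
  from has_derivative_compose[OF this D]
  have *: "((\<lambda>z. \<psi> (y - z)) has_derivative (\<lambda>h. ?D (- h))) (at z)" .
  then show "(\<lambda>z. \<psi> (y - z)) differentiable (at z)" by (auto simp: differentiable_def)
  show "partial_deriv j (\<lambda>z. \<psi> (y - z)) z = - partial_deriv j \<psi> (y - z)"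
    using frechet_derivative_at[OF *] has_derivative_bounded_linear[OF D]
    by (simp add: partial_deriv_def linear_simps fun_eq_iff)
qed

text \<open>The heart of the argument. Here \<open>v j\<close> stands for \<open>A\<^sub>j u\<close> and \<open>w\<close> for the zero-order term
  \<open>(B - div A) u\<close>; the identity at \<open>x\<close> is multiplied by \<open>\<psi> x\<close> and integrated over \<open>x\<close>. Passing to adjoints
  replaces the flux of \<open>v j\<close> by the flux of \<open>z \<mapsto> \<psi> (y - z)\<close>, which by the divergence theorem is
  minus the integral of \<open>\<partial>\<^sub>j \<psi>\<close> over a cube with corner \<open>y\<close>. After division by the volume of the
  cube, the averages converge boundedly as the side tends to zero.\<close>

lemma weak_equation_of_cube_identities:
  fixes v :: "'n \<Rightarrow> real^'n::finite \<Rightarrow> 'b::euclidean_space" and w \<psi> :: "real^'n \<Rightarrow> 'b"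
  assumes v: "\<And>j. integrable lborel (v j)" and w: "integrable lborel w"
    and d\<psi>: "\<And>x. \<psi> differentiable (at x)" and c\<psi>: "\<And>j. continuous_on UNIV (partial_deriv j \<psi>)"
    and b\<psi>: "bounded (range \<psi>)" and bd\<psi>: "\<And>j. bounded (range (partial_deriv j \<psi>))"
    and \<delta>: "0 < \<delta>"
    and id: "\<And>r. 0 < r \<Longrightarrow> r < \<delta> \<Longrightarrow> AE x in lborel. \<psi> x \<noteq> 0 \<longrightarrow>
      (\<Sum>j\<in>UNIV. \<integral>s. (outward s $ j) *\<^sub>R v j (x + facet_point r s) \<partial>facets r)
      + (LINT z:cube r 0|lborel. w (x + z)) = 0"
  shows "(\<integral>y. w y \<bullet> \<psi> y \<partial>lborel) = (\<Sum>j\<in>UNIV. \<integral>y. v j y \<bullet> partial_deriv j \<psi> y \<partial>lborel)"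
proof -
  have cont: "continuous_on UNIV \<psi>"
    using d\<psi> by (simp add: continuous_on_eq_continuous_at differentiable_imp_continuous_within)
  note \<psi>_meas = borel_measurable_continuous_onI[OF cont]
  obtain D where D: "\<And>x. norm (\<psi> x) \<le> D" using b\<psi> by (auto simp: bounded_iff)
  have "\<forall>j. \<exists>D. \<forall>x. norm (partial_deriv j \<psi> x) \<le> D" using bd\<psi> by (auto simp: bounded_iff)
  then obtain D' where D': "\<And>j x. norm (partial_deriv j \<psi> x) \<le> D' j" by metis
  \<comment> \<open>Any null sequence in the open interval up to \<open>\<delta>\<close> would do.\<close>
  define \<rho> where "\<rho> N = \<delta> / real (N + 2)" for N
  have \<rho>: "0 < \<rho> N" "\<rho> N < \<delta>" for N using \<delta> 
    using mult_strict_left_mono[of 1 "real (N + 2)" \<delta>] by (auto simp: \<rho>_def divide_less_eq)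
  have \<rho>0: "\<rho> \<longlonglongrightarrow> 0"
    unfolding \<rho>_def by (intro LIMSEQ_ignore_initial_segment lim_const_over_n)
  have step: "(\<integral>y. w y \<bullet> cube_mean r \<psi> y \<partial>lborel)
        = (\<Sum>j\<in>UNIV. \<integral>y. v j y \<bullet> cube_mean r (partial_deriv j \<psi>) y \<partial>lborel)"
      and meas_w: "(\<lambda>y. w y \<bullet> cube_mean r \<psi> y) \<in> borel_measurable borel"
      and meas_v: "\<And>j. (\<lambda>y. v j y \<bullet> cube_mean r (partial_deriv j \<psi>) y) \<in> borel_measurable borel"
    if r: "0 < r" "r < \<delta>" for r
  proof -
    let ?c = "1 / r ^ CARD('n)"
    let ?R = "restrict_space lborel (cube r (0::real^'n))"
    have fin_R: "finite_measure ?R"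
      using r by (intro finite_measureI) (simp add: space_restrict_space emeasure_restrict_space emeasure_cube)
    have R: "(\<integral>z. f z \<partial>?R) = (LINT z:cube r 0|lborel. f z)" for f :: "real^'n \<Rightarrow> 'b"
      by (simp add: integral_restrict_space set_lebesgue_integral_def)
    have id_R: "(\<lambda>z. z) \<in> borel_measurable ?R" by (simp add: measurable_restrict_space1)
    note av = averaging_adjoint[OF finite_measure_facets[OF r(1)] measurable_facet_point measurable_outward_nth abs_outward_nth_le v \<psi>_meas D]
    note aw = averaging_adjoint[OF fin_R id_R, of "\<lambda>_. 1" 1, OF _ _ w \<psi>_meas D, simplified, unfolded R]
    have flux: "(\<integral>s. (outward s $ j) *\<^sub>R \<psi> (y - facet_point r s) \<partial>facets r)
        = - (LINT z:cube r 0|lborel. partial_deriv j \<psi> (y - z))" for j y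
    proof -
      have "(LINT z:cube r 0|lborel. - partial_deriv j \<psi> (y - (0 + z)))
          = (\<integral>s. (outward s $ j) *\<^sub>R \<psi> (y - (0 + facet_point r s)) \<partial>facets r)"
        by (rule cube_divergence_theorem[OF r(1)])
           (auto intro!: continuous_intros continuous_on_compose2[OF cont] continuous_on_compose2[OF c\<psi>]
              partial_deriv_reflected[OF d\<psi>])
      then show ?thesis by (simp add: set_lebesgue_integral_def)
    qed
    have mean: "?c *\<^sub>R (LINT z:cube r 0|lborel. \<eta> (y - z)) = cube_mean r \<eta> y" for \<eta> :: "real^'n \<Rightarrow> 'b" and y
      by (simp add: cube_mean_def)
    have "integrable lborel (\<lambda>y. ?c * (w y \<bullet> (LINT z:cube r 0|lborel. \<psi> (y - z))))"
      using aw(2) by simp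
    then have "integrable lborel (\<lambda>y. w y \<bullet> cube_mean r \<psi> y)"
      unfolding inner_scaleR_right[symmetric] mean .
    then show "(\<lambda>y. w y \<bullet> cube_mean r \<psi> y) \<in> borel_measurable borel" by auto
    have "integrable lborel (\<lambda>y. - ?c * (v j y \<bullet> - (LINT z:cube r 0|lborel. partial_deriv j \<psi> (y - z))))" for j
      using av(2)[of j, unfolded flux] by (intro integrable_mult_right)
    then have "integrable lborel (\<lambda>y. v j y \<bullet> cube_mean r (partial_deriv j \<psi>) y)" for j
      by (simp add: cube_mean_def)
    then show "\<And>j. (\<lambda>y. v j y \<bullet> cube_mean r (partial_deriv j \<psi>) y) \<in> borel_measurable borel" by auto
    have "0 = (\<integral>x. (\<Sum>j\<in>UNIV. \<psi> x \<bullet> (\<integral>s. (outward s $ j) *\<^sub>R v j (x + facet_point r s) \<partial>facets r))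
        + \<psi> x \<bullet> (LINT z:cube r 0|lborel. w (x + z)) \<partial>lborel)"
    proof -
      have "AE x in lborel. (\<Sum>j\<in>UNIV. \<psi> x \<bullet> (\<integral>s. (outward s $ j) *\<^sub>R v j (x + facet_point r s) \<partial>facets r))
        + \<psi> x \<bullet> (LINT z:cube r 0|lborel. w (x + z)) = 0"
        using id[OF r]
      proof eventually_elim
        case (elim x)
        then show ?case
          by (cases "\<psi> x = 0") (simp_all add: inner_sum_right[symmetric] inner_add_right[symmetric])
      qed
      then show ?thesis by (intro integral_eq_zero_AE[symmetric])
    qed
    also have "\<dots> = (\<Sum>j\<in>UNIV. \<integral>x. \<psi> x \<bullet> (\<integral>s. (outward s $ j) *\<^sub>R v j (x + facet_point r s) \<partial>facets r) \<partial>lborel)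
        + (\<integral>x. \<psi> x \<bullet> (LINT z:cube r 0|lborel. w (x + z)) \<partial>lborel)"
      using av(1) aw(1) by (subst Bochner_Integration.integral_add) (auto intro!: Bochner_Integration.integrable_sum)
    also have "\<dots> = (\<Sum>j\<in>UNIV. \<integral>y. v j y \<bullet> - (LINT z:cube r 0|lborel. partial_deriv j \<psi> (y - z)) \<partial>lborel)
        + (\<integral>y. w y \<bullet> (LINT z:cube r 0|lborel. \<psi> (y - z)) \<partial>lborel)"
      unfolding av(3) aw(3) flux ..
    finally have "?c * (\<integral>y. w y \<bullet> (LINT z:cube r 0|lborel. \<psi> (y - z)) \<partial>lborel)
        = (\<Sum>j\<in>UNIV. ?c * (\<integral>y. v j y \<bullet> (LINT z:cube r 0|lborel. partial_deriv j \<psi> (y - z)) \<partial>lborel))"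
      by (simp add: sum_negf sum_divide_distrib)
    then show "(\<integral>y. w y \<bullet> cube_mean r \<psi> y \<partial>lborel)
        = (\<Sum>j\<in>UNIV. \<integral>y. v j y \<bullet> cube_mean r (partial_deriv j \<psi>) y \<partial>lborel)"
      by (simp add: cube_mean_def sum_divide_distrib)
  qed
  have "(\<lambda>N. \<Sum>j\<in>UNIV. \<integral>y. v j y \<bullet> cube_mean (\<rho> N) (partial_deriv j \<psi>) y \<partial>lborel)
      \<longlonglongrightarrow> (\<Sum>j\<in>UNIV. \<integral>y. v j y \<bullet> partial_deriv j \<psi> y \<partial>lborel)"
    by (intro tendsto_sum integral_cube_mean_tendsto[OF v c\<psi> D' \<rho>(1) \<rho>0] meas_v \<rho>)
  moreover have "(\<lambda>N. \<integral>y. w y \<bullet> cube_mean (\<rho> N) \<psi> y \<partial>lborel) \<longlonglongrightarrow> (\<integral>y. w y \<bullet> \<psi> y \<partial>lborel)"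
    by (intro integral_cube_mean_tendsto[OF w cont D \<rho>(1) \<rho>0] meas_w \<rho>)
  ultimately show ?thesis
    unfolding step[OF \<rho>] by (rule LIMSEQ_unique[rotated])
qed

section \<open>The operator on distributions\<close>

lemma smooth_onD:
  assumes "open S" "smooth_on f S"
  shows "continuous_on S f" "x \<in> S \<Longrightarrow> f differentiable (at x)" "continuous_on S (partial_deriv j f)"
proof -
  have "Ck_on 0 f S" "Ck_on (Suc 0) f S" using assms(2) unfolding smooth_on_def by blast+
  then show "continuous_on S f" "x \<in> S \<Longrightarrow> f differentiable (at x)" "continuous_on S (partial_deriv j f)"
    using assms(1) by (auto simp: differentiable_on_eq_differentiable_at)
qed

text \<open>The product rule, moved across the adjoint. As the adjoint is not given by a formula, it is first
  expanded in the standard basis; the sum over the basis is contracted again at the end by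
  linearity.\<close>

lemma inner_partial_deriv_adjoint:
  fixes M :: "real^'n::finite \<Rightarrow> 'e::euclidean_space \<Rightarrow>\<^sub>L 'f::euclidean_space"
  assumes M: "M differentiable (at x)" and \<psi>: "\<psi> differentiable (at x)"
  shows "e \<bullet> partial_deriv j (\<lambda>x. adjoint (blinfun_apply (M x)) (\<psi> x)) x
    = blinfun_apply (M x) e \<bullet> partial_deriv j \<psi> x + blinfun_apply (partial_deriv j M x) e \<bullet> \<psi> x"
proof -
  have expand: "adjoint (blinfun_apply (M x)) (\<psi> x) = (\<Sum>b\<in>Basis. (blinfun_apply (M x) b \<bullet> \<psi> x) *\<^sub>R b)" for x
    using adjoint_works[OF bounded_linear.linear[OF blinfun.bounded_linear_right], of _ "M x" "\<psi> x"]
    by (subst euclidean_representation[symmetric]) (simp add: inner_commute)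
  let ?M' = "frechet_derivative M (at x)" and ?\<psi>' = "frechet_derivative \<psi> (at x)"
  have M': "(M has_derivative ?M') (at x)" and \<psi>': "(\<psi> has_derivative ?\<psi>') (at x)"
    using M \<psi> by (auto simp: frechet_derivative_works)
  have "((\<lambda>x. adjoint (blinfun_apply (M x)) (\<psi> x)) has_derivative
      (\<lambda>h. \<Sum>b\<in>Basis. (blinfun_apply (M x) b \<bullet> ?\<psi>' h + blinfun_apply (?M' h) b \<bullet> \<psi> x) *\<^sub>R b)) (at x)"
    unfolding expand
    by (intro has_derivative_sum has_derivative_scaleR_left has_derivative_inner \<psi>'
        bounded_linear.has_derivative[OF blinfun.bounded_linear_left M'])
  from frechet_derivative_at[OF this]
  have "partial_deriv j (\<lambda>x. adjoint (blinfun_apply (M x)) (\<psi> x)) x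
      = (\<Sum>b\<in>Basis. (blinfun_apply (M x) b \<bullet> partial_deriv j \<psi> x
          + blinfun_apply (partial_deriv j M x) b \<bullet> \<psi> x) *\<^sub>R b)"
    by (simp add: partial_deriv_def fun_eq_iff)
  then have "e \<bullet> partial_deriv j (\<lambda>x. adjoint (blinfun_apply (M x)) (\<psi> x)) x
      = (\<Sum>b\<in>Basis. (e \<bullet> b) * (blinfun_apply (M x) b \<bullet> partial_deriv j \<psi> x))
        + (\<Sum>b\<in>Basis. (e \<bullet> b) * (blinfun_apply (partial_deriv j M x) b \<bullet> \<psi> x))"
    by (simp add: inner_sum_right sum.distrib[symmetric] algebra_simps)
  also have "\<dots> = blinfun_apply (M x) (\<Sum>b\<in>Basis. (e \<bullet> b) *\<^sub>R b) \<bullet> partial_deriv j \<psi> x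
      + blinfun_apply (partial_deriv j M x) (\<Sum>b\<in>Basis. (e \<bullet> b) *\<^sub>R b) \<bullet> \<psi> x"
    by (simp only: blinfun.sum_right blinfun.scaleR_right inner_sum_left inner_scaleR_left)
  finally show ?thesis by (simp add: euclidean_representation)
qed

text \<open>Measurability is obtained in coordinates: only the functions \<open>y \<mapsto> M y b\<close> for basis vectors \<open>b\<close>
  are needed, and these are continuous on \<open>K\<close>.\<close>

lemma integrable_coefficient_apply:
  fixes M :: "real^'n::finite \<Rightarrow> 'e::euclidean_space \<Rightarrow>\<^sub>L 'f::euclidean_space"
  assumes K: "compact K" and M: "continuous_on K M" and u: "set_integrable lborel K u"
  shows "integrable lborel (\<lambda>y. indicator K y *\<^sub>R blinfun_apply (M y) (u y))"
proof -
  have Kb: "K \<in> sets borel" using K by (simp add: borel_compact)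
  obtain C where C: "\<And>y. y \<in> K \<Longrightarrow> norm (M y) \<le> C"
    using compact_imp_bounded[OF compact_continuous_image[OF M K]] by (auto simp: bounded_iff)
  have u_meas: "(\<lambda>y. indicator K y *\<^sub>R u y) \<in> borel_measurable borel"
    using u by (auto simp: set_integrable_def)
  have Mb: "(\<lambda>y. indicator K y *\<^sub>R blinfun_apply (M y) b) \<in> borel_measurable borel" for b
    by (rule borel_measurable_continuous_on_indicator[OF Kb]) (intro continuous_intros M)
  have "(\<lambda>y. \<Sum>b\<in>Basis. ((indicator K y *\<^sub>R u y) \<bullet> b) *\<^sub>R (indicator K y *\<^sub>R blinfun_apply (M y) b)) \<in> borel_measurable borel"
    by (intro borel_measurable_sum
        borel_measurable_scaleR[OF borel_measurable_inner[OF u_meas borel_measurable_const] Mb])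
  also have "(\<lambda>y. \<Sum>b\<in>Basis. ((indicator K y *\<^sub>R u y) \<bullet> b) *\<^sub>R (indicator K y *\<^sub>R blinfun_apply (M y) b))
      = (\<lambda>y. indicator K y *\<^sub>R blinfun_apply (M y) (u y))"
  proof
    fix y
    have "blinfun_apply (M y) (u y) = blinfun_apply (M y) (\<Sum>b\<in>Basis. (u y \<bullet> b) *\<^sub>R b)"
      by (simp add: euclidean_representation)
    also have "\<dots> = (\<Sum>b\<in>Basis. (u y \<bullet> b) *\<^sub>R blinfun_apply (M y) b)"
      by (simp only: blinfun.sum_right blinfun.scaleR_right)
    finally show "(\<Sum>b\<in>Basis. ((indicator K y *\<^sub>R u y) \<bullet> b) *\<^sub>R (indicator K y *\<^sub>R blinfun_apply (M y) b))
      = indicator K y *\<^sub>R blinfun_apply (M y) (u y)"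
      by (auto split: split_indicator)
  qed
  finally have meas: "(\<lambda>y. indicator K y *\<^sub>R blinfun_apply (M y) (u y)) \<in> borel_measurable borel" .
  have "integrable lborel (\<lambda>y. C * norm (indicator K y *\<^sub>R u y))"
    using u by (intro integrable_mult_right integrable_norm) (simp add: set_integrable_def)
  then show ?thesis
  proof (rule Bochner_Integration.integrable_bound)
    show "AE y in lborel. norm (indicator K y *\<^sub>R blinfun_apply (M y) (u y)) \<le> norm (C * norm (indicator K y *\<^sub>R u y))"
    proof (rule AE_I2)
      fix y
      have "norm (blinfun_apply (M y) (u y)) \<le> C * norm (u y)" if "y \<in> K"
        using norm_blinfun[of "M y" "u y"] mult_right_mono[OF C[OF that] norm_ge_zero] by (rule order_trans)
      then show "norm (indicator K y *\<^sub>R blinfun_apply (M y) (u y)) \<le> norm (C * norm (indicator K y *\<^sub>R u y))"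
        by (auto split: split_indicator intro: order_trans[OF _ abs_ge_self])
    qed
  qed (use meas in simp)
qed

lemma support_zero:
  assumes "x \<notin> closure {x. \<psi> x \<noteq> 0}"
  shows "\<psi> x = 0" and "partial_deriv j \<psi> x = 0"
proof -
  show "\<psi> x = 0" using assms closure_subset[of "{x. \<psi> x \<noteq> 0}"] by auto
  have "(\<psi> has_derivative (\<lambda>_. 0)) (at x)"
  proof (rule has_derivative_transform_within_open)
    show "((\<lambda>_. 0) has_derivative (\<lambda>_. 0)) (at x)" by simp
    show "open (- closure {x. \<psi> x \<noteq> 0})" by (intro open_Compl closed_closure)
    show "0 = \<psi> y" if "y \<in> - closure {x. \<psi> x \<noteq> 0}" for y
      using that closure_subset[of "{x. \<psi> x \<noteq> 0}"] by auto
  qed (use assms in simp)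
  from frechet_derivative_at[OF this] show "partial_deriv j \<psi> x = 0"
    by (simp add: partial_deriv_def fun_eq_iff)
qed

lemma bounded_range_of_compact_support:
  assumes "compact K" "continuous_on UNIV f" "\<And>x. x \<notin> K \<Longrightarrow> f x = 0"
  shows "bounded (range f)"
proof -
  have "bounded (insert 0 (f ` K))"
    using compact_continuous_image[OF continuous_on_subset[OF assms(2)] assms(1)]
    by (simp add: compact_imp_bounded)
  moreover have "range f \<subseteq> insert 0 (f ` K)" using assms(3) by blast
  ultimately show ?thesis by (rule bounded_subset)
qed

text \<open>The duality definition of the operator, written as an honest integral over a compact set \<open>K\<close> that
  contains the support of \<open>\<psi>\<close>. The derivatives of the coefficients produced by the product rule
  add up to \<open>div_symbol A\<close>. Cutting off at \<open>K\<close> makes all integrands globally integrable.\<close>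

lemma dist_first_order_op_eq:
  fixes A :: "'n::finite \<Rightarrow> real^'n \<Rightarrow> 'e::euclidean_space \<Rightarrow>\<^sub>L 'f::euclidean_space"
  assumes \<Omega>: "open \<Omega>" and A: "\<And>j. smooth_on (A j) \<Omega>" and B: "smooth_on B \<Omega>"
    and \<psi>: "smooth_on \<psi> UNIV"
    and K: "compact K" "closure {x. \<psi> x \<noteq> 0} \<subseteq> K" "K \<subseteq> \<Omega>" and u: "set_integrable lborel K u"
  shows "dist_first_order_op A B (dist_of_fun \<Omega> u) \<psi>
    = (\<integral>y. (indicator K y *\<^sub>R blinfun_apply (B y - div_symbol A y) (u y)) \<bullet> \<psi> y \<partial>lborel)
      - (\<Sum>j\<in>UNIV. \<integral>y. (indicator K y *\<^sub>R blinfun_apply (A j y) (u y)) \<bullet> partial_deriv j \<psi> y \<partial>lborel)"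
proof -
  note \<psi>D = smooth_onD[OF open_UNIV \<psi>]
  have outside: "\<psi> x = 0" "partial_deriv j \<psi> x = 0" if "x \<notin> K" for x j
    using support_zero[of x \<psi>] that K(2) by blast+
  note b\<psi> = bounded_range_of_compact_support[OF K(1) \<psi>D(1) outside(1)]
  note bd\<psi> = bounded_range_of_compact_support[OF K(1) \<psi>D(3) outside(2)]
  note onK = continuous_on_subset[OF _ K(3)]
  let ?ap = "\<lambda>M y. indicator K y *\<^sub>R blinfun_apply (M y) (u y)"
  have pairing: "integrable lborel (\<lambda>y. ?ap M y \<bullet> \<eta> y)"
    if M: "continuous_on \<Omega> M" and \<eta>: "continuous_on UNIV \<eta>" "bounded (range \<eta>)" for M and \<eta> :: "real^'n \<Rightarrow> 'f"
  proof -
    obtain D where D: "\<And>x. norm (\<eta> x) \<le> D" using \<eta>(2) by (auto simp: bounded_iff)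
    have int: "integrable lborel (?ap M)"
      by (rule integrable_coefficient_apply[OF K(1) onK[OF M] u])
    show ?thesis
    proof (rule Bochner_Integration.integrable_bound)
      show "integrable lborel (\<lambda>y. norm (?ap M y) * D)" using int by (intro integrable_mult_left integrable_norm)
      show "(\<lambda>y. ?ap M y \<bullet> \<eta> y) \<in> borel_measurable lborel"
        using borel_measurable_inner[OF borel_measurable_integrable[OF int], of \<eta>]
          borel_measurable_continuous_onI[OF \<eta>(1)] by simp
      show "AE y in lborel. norm (?ap M y \<bullet> \<eta> y) \<le> norm (norm (?ap M y) * D)"
        unfolding real_norm_def
        by (intro AE_I2 order_trans[OF Cauchy_Schwarz_ineq2] order_trans[OF _ abs_ge_self] mult_left_mono D norm_ge_zero)
    qed
  qed
  have int_A: "integrable lborel (\<lambda>y. ?ap (A j) y \<bullet> partial_deriv j \<psi> y)" for j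
    by (rule pairing[OF smooth_onD(1)[OF \<Omega> A] \<psi>D(3) bd\<psi>])
  have int_dA: "integrable lborel (\<lambda>y. ?ap (partial_deriv j (A j)) y \<bullet> \<psi> y)" for j
    by (rule pairing[OF smooth_onD(3)[OF \<Omega> A] \<psi>D(1) b\<psi>])
  have int_B: "integrable lborel (\<lambda>y. ?ap B y \<bullet> \<psi> y)"
    by (rule pairing[OF smooth_onD(1)[OF \<Omega> B] \<psi>D(1) b\<psi>])
  have "dist_mult (A j) (dist_deriv j (dist_of_fun \<Omega> u)) \<psi>
      = - (\<integral>y. ?ap (A j) y \<bullet> partial_deriv j \<psi> y \<partial>lborel) - (\<integral>y. ?ap (partial_deriv j (A j)) y \<bullet> \<psi> y \<partial>lborel)" for j
  proof -
    have "indicator \<Omega> y *\<^sub>R (u y \<bullet> partial_deriv j (\<lambda>x. adjoint (blinfun_apply (A j x)) (\<psi> x)) y)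
        = ?ap (A j) y \<bullet> partial_deriv j \<psi> y + ?ap (partial_deriv j (A j)) y \<bullet> \<psi> y" for y
    proof (cases "y \<in> \<Omega>")
      case True
      show ?thesis
        unfolding inner_partial_deriv_adjoint[OF smooth_onD(2)[OF \<Omega> A True] \<psi>D(2)[OF UNIV_I]]
        using True outside[of y] by (cases "y \<in> K") auto
    next
      case False
      then have "y \<notin> K" using K(3) by blast
      with False show ?thesis by simp
    qed
    then show ?thesis
      by (simp only: dist_mult_def dist_deriv_def dist_of_fun_def set_lebesgue_integral_def
        Bochner_Integration.integral_add[OF int_A int_dA] minus_add_distrib diff_conv_add_uminus)
  qed
  moreover have "dist_mult B (dist_of_fun \<Omega> u) \<psi> = (\<integral>y. ?ap B y \<bullet> \<psi> y \<partial>lborel)"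
  proof -
    have "indicator \<Omega> y *\<^sub>R (u y \<bullet> adjoint (blinfun_apply (B y)) (\<psi> y)) = ?ap B y \<bullet> \<psi> y" for y
      using outside(1)[of y] K(3)
      by (cases "y \<in> K") (auto simp: adjoint_works[OF bounded_linear.linear[OF blinfun.bounded_linear_right]] split: split_indicator)
    then show ?thesis by (simp add: dist_mult_def dist_of_fun_def set_lebesgue_integral_def)
  qed
  moreover have "(\<integral>y. ?ap (\<lambda>y. B y - div_symbol A y) y \<bullet> \<psi> y \<partial>lborel)
      = (\<integral>y. ?ap B y \<bullet> \<psi> y \<partial>lborel) - (\<Sum>j\<in>UNIV. \<integral>y. ?ap (partial_deriv j (A j)) y \<bullet> \<psi> y \<partial>lborel)"
  proof -
    have "?ap (\<lambda>y. B y - div_symbol A y) y \<bullet> \<psi> y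
        = ?ap B y \<bullet> \<psi> y - (\<Sum>j\<in>UNIV. ?ap (partial_deriv j (A j)) y \<bullet> \<psi> y)" for y
      by (simp add: div_symbol_def blinfun.diff_left blinfun.sum_left inner_diff_left inner_sum_left
        right_diff_distrib sum_distrib_left)
    then show ?thesis
      by (simp only: Bochner_Integration.integral_diff[OF int_B Bochner_Integration.integrable_sum[OF int_dA]]
        Bochner_Integration.integral_sum[OF int_dA])
  qed
  ultimately show ?thesis
    by (simp add: dist_first_order_op_def sum_subtractf sum_negf)
qed

text \<open>The integrability hypothesis is what allows the integral to be taken term by term. Without it the
  left-hand side could be zero only by the convention for non-integrable functions.\<close>

lemma surface_flux_eq:
  fixes A :: "'n::finite \<Rightarrow> real^'n \<Rightarrow> 'e::euclidean_space \<Rightarrow>\<^sub>L 'f::euclidean_space" and u x K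
  defines "v \<equiv> \<lambda>j y. indicator K y *\<^sub>R blinfun_apply (A j y) (u y)"
  assumes r: "0 < r" and K: "closure (cube r x) \<subseteq> K"
    and meas: "\<And>j. v j \<in> borel_measurable borel"
    and int: "\<And>j. integrable (facets r) (\<lambda>s. (outward s $ j) *\<^sub>R v j (x + facet_point r s))"
  shows "(LINT y|cube_surface r x. blinfun_apply (principal_symbol A y (cube_normal r x y)) (u y))
    = (\<Sum>j\<in>UNIV. \<integral>s. (outward s $ j) *\<^sub>R v j (x + facet_point r s) \<partial>facets r)"
proof -
  let ?F = "restrict_space borel (frontier (cube r x))"
  have normal: "(\<lambda>y. cube_normal r x y $ j) \<in> borel_measurable ?F" for j
  proof -
    have "cube_normal r x \<in> borel_measurable ?F"
      using green_data_cube[OF r, of x] by (simp add: green_data_def cube_surface_def)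
    then show ?thesis
      by (rule measurable_compose) (intro borel_measurable_continuous_onI continuous_intros)
  qed
  have "(LINT y|cube_surface r x. blinfun_apply (principal_symbol A y (cube_normal r x y)) (u y))
      = (LINT y|cube_surface r x. (\<Sum>j\<in>UNIV. (cube_normal r x y $ j) *\<^sub>R v j y))"
  proof (rule Bochner_Integration.integral_cong[OF refl])
    fix y assume "y \<in> space (cube_surface r x)"
    then have "y \<in> K" using K by (auto simp: cube_surface_def space_restrict_space frontier_cube[OF r])
    then show "blinfun_apply (principal_symbol A y (cube_normal r x y)) (u y)
        = (\<Sum>j\<in>UNIV. (cube_normal r x y $ j) *\<^sub>R v j y)"
      by (simp add: principal_symbol_def v_def blinfun.sum_left blinfun.scaleR_left)
  qed
  also have "\<dots> = (\<integral>s. (\<Sum>j\<in>UNIV. (cube_normal r x (x + facet_point r s) $ j) *\<^sub>R v j (x + facet_point r s)) \<partial>facets r)"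
    unfolding cube_surface_def
    by (rule integral_distr[OF measurable_to_frontier[OF r]])
       (intro borel_measurable_sum borel_measurable_scaleR normal measurable_restrict_space1 meas)
  also have "\<dots> = (\<integral>s. (\<Sum>j\<in>UNIV. (outward s $ j) *\<^sub>R v j (x + facet_point r s)) \<partial>facets r)"
    by (rule Bochner_Integration.integral_cong) (auto simp: cube_normal_facet_point[OF r])
  also have "\<dots> = (\<Sum>j\<in>UNIV. \<integral>s. (outward s $ j) *\<^sub>R v j (x + facet_point r s) \<partial>facets r)"
    by (rule Bochner_Integration.integral_sum) (rule int)
  finally show ?thesis .
qed

theorem theorem4p16:
  fixes \<Omega> :: "(real^'n::finite) set"
    and A :: "'n \<Rightarrow> real^'n \<Rightarrow> 'e::euclidean_space \<Rightarrow>\<^sub>L 'f::euclidean_space"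
    and B :: "real^'n \<Rightarrow> 'e \<Rightarrow>\<^sub>L 'f"
    and u :: "real^'n \<Rightarrow> 'e"
    and p :: ennreal
  assumes "open \<Omega>" and "connected \<Omega>"
    and "\<And>j. smooth_on (A j) \<Omega>" and "smooth_on B \<Omega>"
    and "1 \<le> p"
    and "in_Lp p (restrict_space lborel \<Omega>) u"
    and "pae_green_domain p \<Omega> (green_identity A B u)"
  shows "dist_eq_zero \<Omega> (dist_first_order_op A B (dist_of_fun \<Omega> u))"
  unfolding dist_eq_zero_def
proof (intro allI impI)
  note \<Omega> = assms(1) and A = assms(3) and B = assms(4)
  fix \<psi> :: "real^'n \<Rightarrow> 'f" assume \<psi>: "test_function \<Omega> \<psi>"
  let ?S = "closure {x. \<psi> x \<noteq> 0}"
  have \<psi>s: "smooth_on \<psi> UNIV" and S: "compact ?S" "?S \<subseteq> \<Omega>"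
    using \<psi> by (auto simp: test_function_def)
  note \<psi>D = smooth_onD[OF open_UNIV \<psi>s]
  obtain e where e: "0 < e" "(\<Union>x\<in>?S. cball x e) \<subseteq> \<Omega>"
    using compact_subset_open_imp_cball_epsilon_subset[OF S(1) \<Omega> S(2)] by blast
  \<comment> \<open>A neighbourhood of the support that contains every cube of side less than \<open>e / n\<close> with corner in
    the support.\<close>
  define K where "K = (\<Union>x\<in>?S. cball x e)"
  have "K = {x + y |x y. x \<in> ?S \<and> y \<in> cball 0 e}"
  proof (intro set_eqI iffI)
    fix y assume "y \<in> K"
    then obtain x where "x \<in> ?S" "y \<in> cball x e" by (auto simp: K_def)
    then show "y \<in> {x + y |x y. x \<in> ?S \<and> y \<in> cball 0 e}"
      by (intro CollectI exI[of _ x] exI[of _ "y - x"]) (auto simp: dist_norm norm_minus_commute)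
  next
    fix y assume "y \<in> {x + y |x y. x \<in> ?S \<and> y \<in> cball 0 e}"
    then obtain x z where "x \<in> ?S" "norm z \<le> e" "y = x + z" by auto
    then show "y \<in> K" unfolding K_def by (intro UN_I[of x]) (auto simp: dist_norm)
  qed
  then have "compact K"
    using compact_sums[OF S(1) compact_cball[of "0::real^'n" e]] by simp
  moreover have "?S \<subseteq> K"
    unfolding K_def using e(1) by (intro subsetI UN_I) auto
  ultimately have K: "compact K" "?S \<subseteq> K" "K \<subseteq> \<Omega>"
    using e(2) unfolding K_def by blast+
  have Kb: "K \<in> sets borel" using K(1) by (rule borel_compact)
  have u: "set_integrable lborel K u"
  proof -
    have "set_integrable (restrict_space lborel \<Omega>) K u"
    proof (rule in_Lp_imp_set_integrable[OF assms(5,6)])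
      show "K \<in> sets (restrict_space lborel \<Omega>)"
        using Kb K(3) \<Omega> by (subst sets_restrict_space_iff) auto
      show "emeasure (restrict_space lborel \<Omega>) K < \<infinity>"
        using K(3) \<Omega> emeasure_compact_finite[OF K(1)] by (subst emeasure_restrict_space) auto
    qed
    then have "integrable lborel (\<lambda>x. indicator \<Omega> x *\<^sub>R indicator K x *\<^sub>R u x)"
      unfolding set_integrable_def using \<Omega> by (subst (asm) integrable_restrict_space) auto
    moreover have "indicator \<Omega> x *\<^sub>R indicator K x *\<^sub>R u x = indicator K x *\<^sub>R u x" for x
      using K(3) by (auto split: split_indicator)
    ultimately show ?thesis by (simp only: set_integrable_def)
  qed
  define v where "v j y = indicator K y *\<^sub>R blinfun_apply (A j y) (u y)" for j y
  define w where "w y = indicator K y *\<^sub>R blinfun_apply (B y - div_symbol A y) (u y)" for y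
  have v: "integrable lborel (v j)" for j
    unfolding v_def by (intro integrable_coefficient_apply K u continuous_on_subset[OF smooth_onD(1)[OF \<Omega> A]])
  have "continuous_on \<Omega> (\<lambda>y. B y - div_symbol A y)"
    unfolding div_symbol_def by (intro continuous_intros smooth_onD[OF \<Omega> A] smooth_onD[OF \<Omega> B])
  then have w: "integrable lborel w"
    unfolding w_def by (intro integrable_coefficient_apply K u) (rule continuous_on_subset[OF _ K(3)])
  obtain \<E> where \<E>: "p_exceptional p \<E>"
    and green: "\<And>U. green_domain U \<Longrightarrow> compactly_inside U \<Omega> \<Longrightarrow> U \<notin> \<E> \<Longrightarrow> green_identity A B u U"
    using assms(7) unfolding pae_green_domain_def by blast
  have "(\<integral>y. w y \<bullet> \<psi> y \<partial>lborel) = (\<Sum>j\<in>UNIV. \<integral>y. v j y \<bullet> partial_deriv j \<psi> y \<partial>lborel)"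
  proof (rule weak_equation_of_cube_identities[OF v w \<psi>D(2)[OF UNIV_I] \<psi>D(3)])
    show "bounded (range \<psi>)"
      by (rule bounded_range_of_compact_support[OF S(1) \<psi>D(1) support_zero(1)[of _ \<psi>]])
    show "bounded (range (partial_deriv j \<psi>))" for j
      by (rule bounded_range_of_compact_support[OF S(1) \<psi>D(3) support_zero(2)[of _ \<psi>]])
    show "0 < e / real CARD('n)" using e by simp
    fix r :: real assume r: "0 < r" "r < e / real CARD('n)"
    \<comment> \<open>Both exceptional sets of positions are null: that of the non-integrable traces, and that of the
      cubes in the exceptional family.\<close>
    have "AE x in lborel. \<forall>j\<in>UNIV. integrable (facets r) (\<lambda>s. (outward s $ j) *\<^sub>R v j (x + facet_point r s))"
      by (rule AE_finite_allI)
         (auto intro!: AE_integrable_translates[OF finite_measure_facets[OF r(1)]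
            measurable_facet_point measurable_outward_nth abs_outward_nth_le v])
    then show "AE x in lborel. \<psi> x \<noteq> 0 \<longrightarrow>
        (\<Sum>j\<in>UNIV. \<integral>s. (outward s $ j) *\<^sub>R v j (x + facet_point r s) \<partial>facets r)
        + (LINT z:cube r 0|lborel. w (x + z)) = 0"
      using AE_cube_not_exceptional[OF r(1) assms(5) \<E>]
    proof (eventually_elim, intro impI)
      case (elim x)
      assume "\<psi> x \<noteq> 0"
      then have x: "x \<in> ?S" using closure_subset[of "{x. \<psi> x \<noteq> 0}"] by auto
      have sub: "closure (cube r x) \<subseteq> K"
      proof
        fix y assume y: "y \<in> closure (cube r x)"
        then have "y - x \<in> closure (cube r 0)"
          using r(1) by (auto simp: mem_closure_cube algebra_simps)
        from norm_closure_cube[OF r(1) this] r(2) have "norm (y - x) \<le> e"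
          by (simp add: field_simps)
        then show "y \<in> K" using x by (auto simp: K_def dist_norm norm_minus_commute)
      qed
      have "compactly_inside (cube r x) \<Omega>"
        using sub K(3) r(1) by (auto simp: compactly_inside_def closure_cube)
      then have "green_identity A B u (cube r x)"
        using elim by (intro green green_domain_cube[OF r(1)]) auto
      then have "(LINT y|cube_surface r x. blinfun_apply (principal_symbol A y (cube_normal r x y)) (u y))
          + (LINT y:cube r x|lborel. blinfun_apply (B y - div_symbol A y) (u y)) = 0"
        using green_data_cube[OF r(1)] unfolding green_identity_def by blast
      moreover have "(LINT y|cube_surface r x. blinfun_apply (principal_symbol A y (cube_normal r x y)) (u y))
          = (\<Sum>j\<in>UNIV. \<integral>s. (outward s $ j) *\<^sub>R v j (x + facet_point r s) \<partial>facets r)"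
        using elim v unfolding v_def by (intro surface_flux_eq[OF r(1) sub]) auto
      moreover have "(LINT y:cube r x|lborel. blinfun_apply (B y - div_symbol A y) (u y))
          = (LINT y:cube r x|lborel. w y)"
        using sub closure_subset[of "cube r x"] by (intro set_lebesgue_integral_cong) (auto simp: w_def)
      moreover have "\<dots> = (LINT z:cube r 0|lborel. w (x + z))"
        using w by (intro set_integral_translate_cube) (auto simp: set_borel_measurable_def)
      ultimately show "(\<Sum>j\<in>UNIV. \<integral>s. (outward s $ j) *\<^sub>R v j (x + facet_point r s) \<partial>facets r)
        + (LINT z:cube r 0|lborel. w (x + z)) = 0" by simp
    qed
  qed
  then show "dist_first_order_op A B (dist_of_fun \<Omega> u) \<psi> = 0"
    unfolding dist_first_order_op_eq[OF \<Omega> A B \<psi>s K u] v_def w_def by simp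
qed

end
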